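(* The theory $\mathrm{RCA}_0^{\Omega}$ proves the equivalences $$\Pi^0_1\text{-TRANS}\leftrightarrow \Sigma^0_1\text{-SEP}^{*}\leftrightarrow \mathrm{U}\Sigma^0_1\text{-SEP}\leftrightarrow (\exists^{2}).$$
   Context: BASE THEORY. Finite types: $0$ (natural numbers), $\sigma\to\tau$, and $\sigma^{*}$ (finite sequences of objects of type $\sigma$); $1=0\to 0$, $2=1\to 0$, $3=2\to 0$. Superscripts indicate types; tuples are coded as single objects where convenient. Equality $=_0$ is primitive; for $\tau=\tau_1\to\dots\to\tau_k\to 0$, $x=_\tau y$ means $(\forall z_1\dots z_k)(xz_1\dots z_k=_0 yz_1\dots z_k)$. $\mathrm{RCA}_0^{\omega}$ is Kohlenbach's higher-order base theory: classical arithmetic in all finite types with combinators, zero, successor, the recursor $R_0$ (primitive recursion with type $0$ values), quantifier-free induction, extensionality $x=_\rho y\to\varphi(x)=_\tau\varphi(y)$ for all $\varphi^{\rho\to\tau}$, and $\mathrm{QF\text{-}AC}^{1,0}$, where $\mathrm{QF\text{-}AC}^{\sigma,\tau}$ is $(\forall x^\sigma)(\exists y^\tau)A_0(x,y)\to(\exists F^{\sigma\to\tau})(\forall x)A_0(x,F(x))$ for quantifier-free $A_0$. $\mathrm{RCA}_0^{\Omega}$ extends $\mathrm{RCA}_0^{\omega}$ (with the types $\sigma^*$) by a predicate $\mathrm{st}$ ("is standard") for each type. A formula is internal if it does not contain $\mathrm{st}$; $(\forall^{\mathrm{st}}x)A$ is $(\forall x)(\mathrm{st}(x)\to A)$, $(\exists^{\mathrm{st}}x)A$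 is $(\exists x)(\mathrm{st}(x)\wedge A)$; $N\in\Omega$ means $\neg\mathrm{st}(N^0)$; $A^{\mathrm{st}}$ is $A$ with all quantifiers (except bounded number quantifiers) relativised to $\mathrm{st}$. Axioms: (i) standardness respects equality, closed terms are standard, a standard functional applied to a standard object is standard, and numbers below a standard number are standard; (ii) Idealization: $(\forall^{\mathrm{st}}x^{\sigma^*})(\exists y^\tau)(\forall z\in x)\varphi(z,y)\to(\exists y)(\forall^{\mathrm{st}}z^{\sigma})\varphi(z,y)$ for internal $\varphi$; (iii) $\mathrm{HAC}_{\mathrm{int}}$: $(\forall^{\mathrm{st}}x^{\rho})(\exists^{\mathrm{st}}y^{\tau})\varphi(x,y)\to(\exists^{\mathrm{st}}\Phi^{\rho\to\tau^*})(\forall^{\mathrm{st}}x)(\exists y\in\Phi(x))\varphi(x,y)$ for internal $\varphi$; (iv) $\mathrm{PF\text{-}TP}_\forall$: $(\forall^{\mathrm{st}}x^\tau)\varphi(x)\to(\forall x^\tau)\varphi(x)$ for internal $\varphi(x)$ with no parameters other than $x$; (v) for certain functionals uniquely specified by a parameter-free internal formula $D$ (e.g. the one in $(\exists^2)$), a constant $\Xi_0$ with the axiom $\mathrm{st}(\Xi_0)\wedge(\forall^{\mathrm{st}}\Xi)[D^{\mathrm{st}}(\Xi)\to \Xi_0$ and $\Xi$ agree on all standard inputs$]$; these constants do not count as parameters in (iv). PRINCIPLES (sets $Z^1$ are given by characteristic functions). $(\exists^2)$: $(\exists\varphi^2)(\forall g^1)[(\exists x^0)g(x)=0\leftrightarrow\varphi(g)=0]$.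 $\Pi^0_1\text{-TRANS}$: $(\forall^{\mathrm{st}}f^1)[(\forall^{\mathrm{st}}n^0)f(n)=0\to(\forall n^0)f(n)=0]$. $\Sigma^0_1\text{-SEP}^*$: for all standard $f_1^1,f_2^1$ and $\varphi_i(n)\equiv(\exists n_i)(f_i(n_i,n)=0)$ such that $(\forall^{\mathrm{st}}n)\neg[\varphi_1^{\mathrm{st}}(n)\wedge\varphi_2^{\mathrm{st}}(n)]$, there is a standard $Z^1$ such that $(\forall n^0)[(\varphi_1(n)\to n\notin Z)\wedge(\varphi_2(n)\to n\in Z)]$. $\mathrm{U}\Sigma^0_1\text{-SEP}$: for $\varphi_i(n,f)\equiv(\exists n_i)(f(n_i,n)=0)$, $i=1,2$, $$(\exists F^{(1\times1\times0)\to0})(\forall f^1,g^1)\big[(\forall n)\neg[\varphi_1(n,f)\wedge\varphi_2(n,g)]\to(\forall n)[\varphi_1(n,f)\to F(f,g,n)=1]\wedge(\forall n)[\varphi_2(n,g)\to F(f,g,n)=0]\big].$$ *)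

theory Defs
  imports Main
begin

section \<open>Language\<close>

datatype ty = N | Arr ty ty (infixr "\<rightarrow>" 80) | Star ty

abbreviation ty1 :: ty where "ty1 \<equiv> N \<rightarrow> N"
abbreviation ty2 :: ty where "ty2 \<equiv> ty1 \<rightarrow> N"

text \<open>
  Variables are de Bruijn indices.  \<open>Len\<close>, \<open>Nth\<close> and \<open>Tab\<close> are length \<open>\<sigma>\<^sup>* \<rightarrow> 0\<close>, projection
  \<open>\<sigma>\<^sup>* \<rightarrow> 0 \<rightarrow> \<sigma>\<close> and \<open>n, f \<mapsto> \<langle>f 0, \<dots>, f (n - 1)\<rangle>\<close>; \<open>Xi k\<close> are the constants for uniquely
  specified functionals, whose types and specifications are given by a signature.
\<close>

datatype tm =
    V nat
  | Xi nat
  | Zero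
  | Sc
  | Comb_K ty ty
  | Comb_S ty ty ty
  | Rec0
  | Len ty
  | Nth ty
  | Tab ty
  | App tm tm (infixl "\<cdot>" 90)

datatype fm =
    Eq tm tm
  | St ty tm
  | Fls
  | Imp fm fm
  | Forall ty fm

type_synonym sig = "nat \<rightharpoonup> ty \<times> fm"

primrec tyof :: "sig \<Rightarrow> ty list \<Rightarrow> tm \<Rightarrow> ty option" where
  "tyof \<Sigma> E (V n) = (if n < length E then Some (E ! n) else None)"
| "tyof \<Sigma> E (Xi k) = map_option fst (\<Sigma> k)"
| "tyof \<Sigma> E Zero = Some N"
| "tyof \<Sigma> E Sc = Some (N \<rightarrow> N)"
| "tyof \<Sigma> E (Comb_K \<sigma> \<tau>) = Some (\<sigma> \<rightarrow> \<tau> \<rightarrow> \<sigma>)"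
| "tyof \<Sigma> E (Comb_S \<rho> \<sigma> \<tau>) = Some ((\<rho> \<rightarrow> \<sigma> \<rightarrow> \<tau>) \<rightarrow> (\<rho> \<rightarrow> \<sigma>) \<rightarrow> \<rho> \<rightarrow> \<tau>)"
| "tyof \<Sigma> E Rec0 = Some (N \<rightarrow> N \<rightarrow> (N \<rightarrow> N \<rightarrow> N) \<rightarrow> N)"
| "tyof \<Sigma> E (Len \<sigma>) = Some (Star \<sigma> \<rightarrow> N)"
| "tyof \<Sigma> E (Nth \<sigma>) = Some (Star \<sigma> \<rightarrow> N \<rightarrow> \<sigma>)"
| "tyof \<Sigma> E (Tab \<sigma>) = Some (N \<rightarrow> (N \<rightarrow> \<sigma>) \<rightarrow> Star \<sigma>)"
| "tyof \<Sigma> E (s \<cdot> t) =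
     (case tyof \<Sigma> E s of
        Some (\<sigma> \<rightarrow> \<tau>) \<Rightarrow> if tyof \<Sigma> E t = Some \<sigma> then Some \<tau> else None
      | _ \<Rightarrow> None)"

primrec wf_fm :: "sig \<Rightarrow> ty list \<Rightarrow> fm \<Rightarrow> bool" where
  "wf_fm \<Sigma> E (Eq s t) \<longleftrightarrow> tyof \<Sigma> E s = Some N \<and> tyof \<Sigma> E t = Some N"
| "wf_fm \<Sigma> E (St \<tau> t) \<longleftrightarrow> tyof \<Sigma> E t = Some \<tau>"
| "wf_fm \<Sigma> E Fls \<longleftrightarrow> True"
| "wf_fm \<Sigma> E (Imp A B) \<longleftrightarrow> wf_fm \<Sigma> E A \<and> wf_fm \<Sigma> E B"
| "wf_fm \<Sigma> E (Forall \<sigma> A) \<longleftrightarrow> wf_fm \<Sigma> (\<sigma> # E) A"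

primrec internal :: "fm \<Rightarrow> bool" where
  "internal (Eq s t) \<longleftrightarrow> True"
| "internal (St \<tau> t) \<longleftrightarrow> False"
| "internal Fls \<longleftrightarrow> True"
| "internal (Imp A B) \<longleftrightarrow> internal A \<and> internal B"
| "internal (Forall \<sigma> A) \<longleftrightarrow> internal A"

primrec quantifier_free :: "fm \<Rightarrow> bool" where
  "quantifier_free (Eq s t) \<longleftrightarrow> True"
| "quantifier_free (St \<tau> t) \<longleftrightarrow> False"
| "quantifier_free Fls \<longleftrightarrow> True"
| "quantifier_free (Imp A B) \<longleftrightarrow> quantifier_free A \<and> quantifier_free B"
| "quantifier_free (Forall \<sigma> A) \<longleftrightarrow> False"

subsection \<open>Parallel substitution\<close>

primrec sb :: "(nat \<Rightarrow> tm) \<Rightarrow> tm \<Rightarrow> tm" where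
  "sb \<theta> (V n) = \<theta> n"
| "sb \<theta> (Xi k) = Xi k"
| "sb \<theta> Zero = Zero"
| "sb \<theta> Sc = Sc"
| "sb \<theta> (Comb_K \<sigma> \<tau>) = Comb_K \<sigma> \<tau>"
| "sb \<theta> (Comb_S \<rho> \<sigma> \<tau>) = Comb_S \<rho> \<sigma> \<tau>"
| "sb \<theta> Rec0 = Rec0"
| "sb \<theta> (Len \<sigma>) = Len \<sigma>"
| "sb \<theta> (Nth \<sigma>) = Nth \<sigma>"
| "sb \<theta> (Tab \<sigma>) = Tab \<sigma>"
| "sb \<theta> (s \<cdot> t) = sb \<theta> s \<cdot> sb \<theta> t"

definition lift :: "tm \<Rightarrow> tm" where
  "lift = sb (\<lambda>n. V (Suc n))"

definition up :: "(nat \<Rightarrow> tm) \<Rightarrow> nat \<Rightarrow> tm" where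
  "up \<theta> = case_nat (V 0) (\<lambda>n. lift (\<theta> n))"

primrec sbf :: "(nat \<Rightarrow> tm) \<Rightarrow> fm \<Rightarrow> fm" where
  "sbf \<theta> (Eq s t) = Eq (sb \<theta> s) (sb \<theta> t)"
| "sbf \<theta> (St \<tau> t) = St \<tau> (sb \<theta> t)"
| "sbf \<theta> Fls = Fls"
| "sbf \<theta> (Imp A B) = Imp (sbf \<theta> A) (sbf \<theta> B)"
| "sbf \<theta> (Forall \<sigma> A) = Forall \<sigma> (sbf (up \<theta>) A)"

definition liftf :: "fm \<Rightarrow> fm" where
  "liftf = sbf (\<lambda>n. V (Suc n))"

definition inst :: "tm \<Rightarrow> fm \<Rightarrow> fm" where
  "inst t = sbf (case_nat t V)"

subsection \<open>Defined connectives and quantifiers\<close>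

abbreviation Neg :: "fm \<Rightarrow> fm" where "Neg A \<equiv> Imp A Fls"
abbreviation And :: "fm \<Rightarrow> fm \<Rightarrow> fm" where "And A B \<equiv> Neg (Imp A (Neg B))"
abbreviation Or :: "fm \<Rightarrow> fm \<Rightarrow> fm" where "Or A B \<equiv> Imp (Neg A) B"
abbreviation Iff :: "fm \<Rightarrow> fm \<Rightarrow> fm" where "Iff A B \<equiv> And (Imp A B) (Imp B A)"
abbreviation Exists :: "ty \<Rightarrow> fm \<Rightarrow> fm" where "Exists \<sigma> A \<equiv> Neg (Forall \<sigma> (Neg A))"
abbreviation ForallSt :: "ty \<Rightarrow> fm \<Rightarrow> fm" where
  "ForallSt \<sigma> A \<equiv> Forall \<sigma> (Imp (St \<sigma> (V 0)) A)"
abbreviation ExistsSt :: "ty \<Rightarrow> fm \<Rightarrow> fm" where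
  "ExistsSt \<sigma> A \<equiv> Exists \<sigma> (And (St \<sigma> (V 0)) A)"

subsection \<open>Arithmetic terms\<close>

text \<open>\<open>\<lambda>r k. f r\<close>\<close>
definition iter_step :: "tm \<Rightarrow> tm" where
  "iter_step f = Comb_S N N (N \<rightarrow> N) \<cdot> (Comb_K (N \<rightarrow> N \<rightarrow> N) N \<cdot> Comb_K N N) \<cdot> f"

definition plus_tm :: "tm \<Rightarrow> tm \<Rightarrow> tm" where
  "plus_tm s t = Rec0 \<cdot> t \<cdot> s \<cdot> iter_step Sc"

text \<open>The argument of the outer \<open>iter_step\<close> is \<open>\<lambda>r. r + s\<close>.\<close>
definition times_tm :: "tm \<Rightarrow> tm \<Rightarrow> tm" where
  "times_tm s t = Rec0 \<cdot> t \<cdot> Zero \<cdot>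
     iter_step (Comb_S N (N \<rightarrow> N \<rightarrow> N) N \<cdot> (Rec0 \<cdot> s) \<cdot> (Comb_K (N \<rightarrow> N \<rightarrow> N) N \<cdot> iter_step Sc))"

text \<open>\<open>\<lambda>n. Rec0 n 0 (\<lambda>r k. k)\<close>\<close>
definition pred_tm :: tm where
  "pred_tm = Comb_S N (N \<rightarrow> N \<rightarrow> N) N
     \<cdot> (Comb_S N N ((N \<rightarrow> N \<rightarrow> N) \<rightarrow> N) \<cdot> Rec0 \<cdot> (Comb_K N N \<cdot> Zero))
     \<cdot> (Comb_K (N \<rightarrow> N \<rightarrow> N) N \<cdot>
         (Comb_K (N \<rightarrow> N) N \<cdot> (Comb_S N (N \<rightarrow> N) N \<cdot> Comb_K N (N \<rightarrow> N) \<cdot> Comb_K N N)))"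

text \<open>Truncated subtraction.\<close>
definition monus_tm :: "tm \<Rightarrow> tm \<Rightarrow> tm" where
  "monus_tm s t = Rec0 \<cdot> t \<cdot> s \<cdot> iter_step pred_tm"

definition One :: tm where
  "One = Sc \<cdot> Zero"

text \<open>The usual pairing \<open>(s + t)\<^sup>2 + s\<close> of second-order arithmetic.\<close>
definition pair_tm :: "tm \<Rightarrow> tm \<Rightarrow> tm" where
  "pair_tm s t = plus_tm (times_tm (plus_tm s t) (plus_tm s t)) s"

definition le_fm :: "tm \<Rightarrow> tm \<Rightarrow> fm" where
  "le_fm s t = Eq (monus_tm s t) Zero"

definition lt_fm :: "tm \<Rightarrow> tm \<Rightarrow> fm" where
  "lt_fm s t = le_fm (Sc \<cdot> s) t"

primrec zero_of :: "ty \<Rightarrow> tm" where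
  "zero_of N = Zero"
| "zero_of (\<sigma> \<rightarrow> \<tau>) = Comb_K \<tau> \<sigma> \<cdot> zero_of \<tau>"
| "zero_of (Star \<sigma>) = Tab \<sigma> \<cdot> Zero \<cdot> (Comb_K \<sigma> N \<cdot> zero_of \<sigma>)"

subsection \<open>Equality in all types, membership in sequences, relativisation\<close>

definition ForallLess :: "tm \<Rightarrow> fm \<Rightarrow> fm" where
  "ForallLess t A = Forall N (Imp (lt_fm (V 0) (lift t)) A)"

primrec eq :: "ty \<Rightarrow> tm \<Rightarrow> tm \<Rightarrow> fm" where
  "eq N s t = Eq s t"
| "eq (\<sigma> \<rightarrow> \<tau>) s t = Forall \<sigma> (eq \<tau> (lift s \<cdot> V 0) (lift t \<cdot> V 0))"
| "eq (Star \<sigma>) s t =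
     And (Eq (Len \<sigma> \<cdot> s) (Len \<sigma> \<cdot> t))
         (ForallLess (Len \<sigma> \<cdot> s) (eq \<sigma> (Nth \<sigma> \<cdot> lift s \<cdot> V 0) (Nth \<sigma> \<cdot> lift t \<cdot> V 0)))"

text \<open>\<open>s \<in> t\<close> for \<open>s\<close> of type \<open>\<sigma>\<close> and \<open>t\<close> of type \<open>\<sigma>\<^sup>*\<close>.\<close>
definition mem :: "ty \<Rightarrow> tm \<Rightarrow> tm \<Rightarrow> fm" where
  "mem \<sigma> s t = Neg (ForallLess (Len \<sigma> \<cdot> t) (Neg (eq \<sigma> (lift s) (Nth \<sigma> \<cdot> lift t \<cdot> V 0))))"

definition bounded_body :: "fm \<Rightarrow> bool" where
  "bounded_body A \<longleftrightarrow>
     (\<exists>t B. A = Imp (le_fm (V 0) (lift t)) B \<or> A = Imp (lt_fm (V 0) (lift t)) B)"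

text \<open>\<open>A\<^sup>s\<^sup>t\<close>: all quantifiers except bounded number quantifiers are restricted to standard objects.
  On \<open>Exists \<sigma> A\<close> this is \<open>\<not> (\<forall>\<^sup>s\<^sup>t x) \<not> A\<^sup>s\<^sup>t\<close>.\<close>
primrec rel :: "fm \<Rightarrow> fm" where
  "rel (Eq s t) = Eq s t"
| "rel (St \<tau> t) = St \<tau> t"
| "rel Fls = Fls"
| "rel (Imp A B) = Imp (rel A) (rel B)"
| "rel (Forall \<sigma> A) =
     (if \<sigma> = N \<and> bounded_body A then Forall \<sigma> (rel A) else ForallSt \<sigma> (rel A))"

section \<open>Provability\<close>

text \<open>
  Classical natural deduction.  \<open>proves \<Sigma> Ax E H A\<close>: in the language with signature \<open>\<Sigma>\<close>, with free
  variables typed by \<open>E\<close>, the formula \<open>A\<close> is derivable from the hypotheses \<open>H\<close> and the axioms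
  \<open>Ax\<close>; \<open>Ax E\<close> are the axioms (possibly with free variables) in the context \<open>E\<close>.
\<close>

inductive proves :: "sig \<Rightarrow> (ty list \<Rightarrow> fm \<Rightarrow> bool) \<Rightarrow> ty list \<Rightarrow> fm list \<Rightarrow> fm \<Rightarrow> bool"
  for \<Sigma> Ax where
  Axm: "Ax E A \<Longrightarrow> wf_fm \<Sigma> E A \<Longrightarrow> proves \<Sigma> Ax E H A"
| Hyp: "A \<in> set H \<Longrightarrow> wf_fm \<Sigma> E A \<Longrightarrow> proves \<Sigma> Ax E H A"
| ImpI: "wf_fm \<Sigma> E A \<Longrightarrow> proves \<Sigma> Ax E (A # H) B \<Longrightarrow> proves \<Sigma> Ax E H (Imp A B)"
| ImpE: "proves \<Sigma> Ax E H (Imp A B) \<Longrightarrow> proves \<Sigma> Ax E H A \<Longrightarrow> proves \<Sigma> Ax E H B"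
| Classical: "wf_fm \<Sigma> E A \<Longrightarrow> proves \<Sigma> Ax E (Neg A # H) Fls \<Longrightarrow> proves \<Sigma> Ax E H A"
| ForallI: "proves \<Sigma> Ax (\<sigma> # E) (map liftf H) A \<Longrightarrow> proves \<Sigma> Ax E H (Forall \<sigma> A)"
| ForallE: "proves \<Sigma> Ax E H (Forall \<sigma> A) \<Longrightarrow> tyof \<Sigma> E t = Some \<sigma> \<Longrightarrow> proves \<Sigma> Ax E H (inst t A)"

section \<open>The theories\<close>

text \<open>
  In the schemata below, the indices from 0 on in \<open>A\<close> are the variables the schema speaks about,
  in the order innermost first, and all further indices are parameters, typed by \<open>E\<close>.
\<close>

inductive RCA0_omega :: "ty list \<Rightarrow> fm \<Rightarrow> bool" where
  Eq_refl: "RCA0_omega E (Eq s s)"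
| Eq_sym: "RCA0_omega E (Imp (Eq s t) (Eq t s))"
| Eq_trans: "RCA0_omega E (Imp (Eq s t) (Imp (Eq t u) (Eq s u)))"
| suc_neq_zero: "RCA0_omega E (Neg (Eq (Sc \<cdot> s) Zero))"
| suc_inj: "RCA0_omega E (Imp (Eq (Sc \<cdot> s) (Sc \<cdot> t)) (Eq s t))"
| comb_K: "RCA0_omega E (eq \<sigma> (Comb_K \<sigma> \<tau> \<cdot> s \<cdot> t) s)"
| comb_S: "RCA0_omega E (eq \<tau> (Comb_S \<rho> \<sigma> \<tau> \<cdot> r \<cdot> s \<cdot> t) (r \<cdot> t \<cdot> (s \<cdot> t)))"
| rec_zero: "RCA0_omega E (Eq (Rec0 \<cdot> Zero \<cdot> s \<cdot> t) s)"
| rec_suc: "RCA0_omega E (Eq (Rec0 \<cdot> (Sc \<cdot> n) \<cdot> s \<cdot> t) (t \<cdot> (Rec0 \<cdot> n \<cdot> s \<cdot> t) \<cdot> n))"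
| len_tab: "RCA0_omega E (Eq (Len \<sigma> \<cdot> (Tab \<sigma> \<cdot> n \<cdot> f)) n)"
| nth_tab: "RCA0_omega E (Imp (lt_fm i n) (eq \<sigma> (Nth \<sigma> \<cdot> (Tab \<sigma> \<cdot> n \<cdot> f) \<cdot> i) (f \<cdot> i)))"
| nth_beyond: "RCA0_omega E (Imp (le_fm (Len \<sigma> \<cdot> s) i) (eq \<sigma> (Nth \<sigma> \<cdot> s \<cdot> i) (zero_of \<sigma>)))"
| extensionality: "RCA0_omega E (Imp (eq \<rho> s t) (eq \<tau> (f \<cdot> s) (f \<cdot> t)))"
| QF_induction: "quantifier_free A \<Longrightarrow>
    RCA0_omega E
      (Imp (And (inst Zero A)
                (Forall N (Imp A (sbf (case_nat (Sc \<cdot> V 0) (\<lambda>k. V (Suc k))) A))))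
           (Forall N A))"
| QF_AC_1_0: "quantifier_free A \<Longrightarrow>
    RCA0_omega E
      (Imp (Forall ty1 (Exists N A))
           (Exists (ty1 \<rightarrow> N) (Forall ty1
              (sbf (case_nat (V 1 \<cdot> V 0) (case_nat (V 0) (\<lambda>k. V (k + 2)))) A))))"

text \<open>Makes room for one further variable, of index 2.\<close>
definition shift2 :: "fm \<Rightarrow> fm" where
  "shift2 = sbf (\<lambda>k. V (if k < 2 then k else Suc k))"

inductive RCA0_Omega :: "sig \<Rightarrow> ty list \<Rightarrow> fm \<Rightarrow> bool" for \<Sigma> where
  base: "RCA0_omega E A \<Longrightarrow> RCA0_Omega \<Sigma> E A"
| st_eq: "RCA0_Omega \<Sigma> E (Imp (And (St \<tau> s) (eq \<tau> s t)) (St \<tau> t))"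
| st_closed: "tyof \<Sigma> [] t = Some \<tau> \<Longrightarrow> RCA0_Omega \<Sigma> E (St \<tau> t)"
| st_app: "RCA0_Omega \<Sigma> E (Imp (And (St (\<sigma> \<rightarrow> \<tau>) s) (St \<sigma> t)) (St \<tau> (s \<cdot> t)))"
| st_leq: "RCA0_Omega \<Sigma> E (Imp (And (St N s) (le_fm t s)) (St N t))"
| idealization: "internal A \<Longrightarrow>
    RCA0_Omega \<Sigma> E
      (Imp (ForallSt (Star \<sigma>) (Exists \<tau> (Forall \<sigma> (Imp (mem \<sigma> (V 0) (V 2)) (shift2 A)))))
           (Exists \<tau> (ForallSt \<sigma> A)))"
| HAC_int: "internal A \<Longrightarrow>
    RCA0_Omega \<Sigma> E
      (Imp (ForallSt \<rho> (ExistsSt \<tau> A))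
           (ExistsSt (\<rho> \<rightarrow> Star \<tau>) (ForallSt \<rho>
              (Exists \<tau> (And (mem \<tau> (V 0) (V 2 \<cdot> V 1)) (shift2 A))))))"
| PF_TP: "internal A \<Longrightarrow> wf_fm \<Sigma> [\<tau>] A \<Longrightarrow>
    RCA0_Omega \<Sigma> E (Imp (ForallSt \<tau> A) (Forall \<tau> A))"
| Xi_spec: "\<Sigma> k = Some (\<tau>, D) \<Longrightarrow>
    RCA0_Omega \<Sigma> E
      (And (St \<tau> (Xi k))
           (ForallSt \<tau> (Imp (rel D) (rel (eq \<tau> (Xi k) (V 0))))))"

section \<open>Principles\<close>

definition exists2 :: fm where
  "exists2 =
     Exists ty2 (Forall ty1 (Iff (Exists N (Eq (V 1 \<cdot> V 0) Zero)) (Eq (V 1 \<cdot> V 0) Zero)))"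

definition Pi01_TRANS :: fm where
  "Pi01_TRANS =
     ForallSt ty1 (Imp (ForallSt N (Eq (V 1 \<cdot> V 0) Zero)) (Forall N (Eq (V 1 \<cdot> V 0) Zero)))"

text \<open>\<open>(\<exists>m) f(m, n) = 0\<close>\<close>
definition Sigma01 :: "tm \<Rightarrow> tm \<Rightarrow> fm" where
  "Sigma01 f n = Exists N (Eq (lift f \<cdot> pair_tm (V 0) (lift n)) Zero)"

definition is_set :: "tm \<Rightarrow> fm" where
  "is_set Z = Forall N (Or (Eq (lift Z \<cdot> V 0) Zero) (Eq (lift Z \<cdot> V 0) One))"

definition elem :: "tm \<Rightarrow> tm \<Rightarrow> fm" where
  "elem n Z = Eq (Z \<cdot> n) One"

text \<open>In the innermost scopes: \<open>f\<^sub>1 = V 2\<close>, \<open>f\<^sub>2 = V 1\<close>, \<open>n = V 0\<close> in the premise and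
  \<open>f\<^sub>1 = V 3\<close>, \<open>f\<^sub>2 = V 2\<close>, \<open>Z = V 1\<close>, \<open>n = V 0\<close> in the conclusion.\<close>
definition Sigma01_SEP_star :: fm where
  "Sigma01_SEP_star =
     ForallSt ty1 (ForallSt ty1
       (Imp (ForallSt N (Neg (And (rel (Sigma01 (V 2) (V 0))) (rel (Sigma01 (V 1) (V 0))))))
            (ExistsSt ty1 (And (is_set (V 0))
               (Forall N (And (Imp (Sigma01 (V 3) (V 0)) (Neg (elem (V 0) (V 1))))
                              (Imp (Sigma01 (V 2) (V 0)) (elem (V 0) (V 1)))))))))"

text \<open>In the innermost scopes: \<open>F = V 3\<close>, \<open>f = V 2\<close>, \<open>g = V 1\<close>, \<open>n = V 0\<close>.\<close>
definition USigma01_SEP :: fm where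
  "USigma01_SEP =
     Exists (ty1 \<rightarrow> ty1 \<rightarrow> N \<rightarrow> N) (Forall ty1 (Forall ty1
       (Imp (Forall N (Neg (And (Sigma01 (V 2) (V 0)) (Sigma01 (V 1) (V 0)))))
            (And (Forall N (Imp (Sigma01 (V 2) (V 0)) (Eq (V 3 \<cdot> V 2 \<cdot> V 1 \<cdot> V 0) One)))
                 (Forall N (Imp (Sigma01 (V 1) (V 0)) (Eq (V 3 \<cdot> V 2 \<cdot> V 1 \<cdot> V 0) Zero)))))))"

section \<open>Constants for uniquely specified functionals\<close>

text \<open>The specification of the functional in \<open>(\<exists>\<^sup>2)\<close>; only with the values restricted to 0 and 1
  does it determine the functional.\<close>
definition exists2_spec :: fm where
  "exists2_spec =
     Forall ty1 (And (Iff (Exists N (Eq (V 1 \<cdot> V 0) Zero)) (Eq (V 1 \<cdot> V 0) Zero))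
                     (Or (Eq (V 1 \<cdot> V 0) Zero) (Eq (V 1 \<cdot> V 0) One)))"

text \<open>The only free variable of \<open>D\<close> is \<open>V 0\<close>, of type \<open>\<tau>\<close>.\<close>
definition uniquely_specifies :: "ty \<Rightarrow> fm \<Rightarrow> bool" where
  "uniquely_specifies \<tau> D \<longleftrightarrow>
     wf_fm Map.empty [\<tau>] D \<and> internal D \<and>
     proves Map.empty RCA0_omega [] []
       (Forall \<tau> (Forall \<tau> (Imp (And (inst (V 1) D) (inst (V 0) D)) (eq \<tau> (V 1) (V 0)))))"

definition admissible :: "sig \<Rightarrow> bool" where
  "admissible \<Sigma> \<longleftrightarrow>
     (\<forall>k \<tau> D. \<Sigma> k = Some (\<tau>, D) \<longrightarrow> uniquely_specifies \<tau> D) \<and>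
     (\<exists>k. \<Sigma> k = Some (ty2, exists2_spec))"

subsection \<open>Admissible signatures exist\<close>

lemma proves_weaken: "proves \<Sigma> Ax E H A \<Longrightarrow> set H \<subseteq> set H' \<Longrightarrow> proves \<Sigma> Ax E H' A"
proof (induction arbitrary: H' rule: proves.induct)
  case (ForallI \<sigma> E H A)
  then have "set (map liftf H) \<subseteq> set (map liftf H')" by auto
  then show ?case using ForallI.IH proves.ForallI by blast
next
  case (ImpI E A H B)
  then have "set (A # H) \<subseteq> set (A # H')" by auto
  then show ?case using ImpI proves.ImpI by blast
next
  case (Classical E A H)
  then have "set (Neg A # H) \<subseteq> set (Neg A # H')" by auto
  then show ?case using Classical proves.Classical by blast
qed (auto intro: proves.intros)

lemma proves_conjD1:
  assumes "proves \<Sigma> Ax E H (And A B)" "wf_fm \<Sigma> E A" "wf_fm \<Sigma> E B"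
  shows "proves \<Sigma> Ax E H A"
proof (rule Classical)
  have "proves \<Sigma> Ax E (A # Neg A # H) Fls"
    by (rule ImpE[of _ _ _ _ A]) (auto intro!: Hyp simp: assms)
  then have "proves \<Sigma> Ax E (B # A # Neg A # H) Fls" by (rule proves_weaken) auto
  then have "proves \<Sigma> Ax E (Neg A # H) (Imp A (Neg B))" by (intro ImpI assms)
  moreover have "proves \<Sigma> Ax E (Neg A # H) (And A B)"
    by (rule proves_weaken[OF assms(1)]) auto
  ultimately show "proves \<Sigma> Ax E (Neg A # H) Fls" by (rule ImpE[rotated])
qed fact

lemma proves_conjD2:
  assumes "proves \<Sigma> Ax E H (And A B)" "wf_fm \<Sigma> E A" "wf_fm \<Sigma> E B"
  shows "proves \<Sigma> Ax E H B"
proof (rule Classical)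
  have "proves \<Sigma> Ax E (A # Neg B # H) (Neg B)" by (auto intro!: Hyp simp: assms)
  then have "proves \<Sigma> Ax E (Neg B # H) (Imp A (Neg B))" by (rule ImpI[OF assms(2)])
  moreover have "proves \<Sigma> Ax E (Neg B # H) (And A B)"
    by (rule proves_weaken[OF assms(1)]) auto
  ultimately show "proves \<Sigma> Ax E (Neg B # H) Fls" by (rule ImpE[rotated])
qed fact

lemma proves_cases:
  assumes "proves \<Sigma> Ax E (A # H) C" "proves \<Sigma> Ax E (Neg A # H) C" "wf_fm \<Sigma> E A" "wf_fm \<Sigma> E C"
  shows "proves \<Sigma> Ax E H C"
proof (rule Classical)
  have 1: "proves \<Sigma> Ax E (Neg C # H) (Imp A C)"
    by (rule ImpI[OF assms(3)], rule proves_weaken[OF assms(1)]) auto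
  have 2: "proves \<Sigma> Ax E (Neg C # H) (Imp (Neg A) C)"
    by (rule ImpI, simp add: assms, rule proves_weaken[OF assms(2)]) auto
  have nC: "proves \<Sigma> Ax E (X # Neg C # H) (Neg C)" for X
    by (auto intro!: Hyp simp: assms)
  have "proves \<Sigma> Ax E (A # Neg C # H) Fls"
    by (rule ImpE[OF nC], rule ImpE[OF proves_weaken[OF 1]]) (auto intro!: Hyp simp: assms)
  then have "proves \<Sigma> Ax E (Neg C # H) (Neg A)" by (rule ImpI[OF assms(3)])
  then have "proves \<Sigma> Ax E (Neg C # H) C" by (rule ImpE[OF 2])
  then show "proves \<Sigma> Ax E (Neg C # H) Fls" by (rule ImpE[rotated]) (auto intro!: Hyp simp: assms)
qed fact

lemma uniquely_specifies_exists2: "uniquely_specifies ty2 exists2_spec"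
proof -
  let ?E = "[ty1, ty2, ty2]"
  let ?P = "Exists N (Eq (V 1 \<cdot> V 0) Zero)"
  let ?a = "V (Suc (Suc 0)) \<cdot> V 0" and ?b = "V (Suc 0) \<cdot> V 0"
  define D where "D = (\<lambda>t. And (Iff ?P (Eq t Zero)) (Or (Eq t Zero) (Eq t One)))"
  let ?H = "[And (Forall ty1 (D (V 3 \<cdot> V 0))) (Forall ty1 (D (V 2 \<cdot> V 0)))]"
  let ?pr = "\<lambda>H. proves Map.empty RCA0_omega ?E (H @ ?H)"
  have wfD: "wf_fm Map.empty ?E (D ?a)" "wf_fm Map.empty ?E (D ?b)"
    "wf_fm Map.empty ?E (Forall ty1 (D (V 3 \<cdot> V 0)))" "wf_fm Map.empty ?E (Forall ty1 (D (V 2 \<cdot> V 0)))"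
    by (simp_all add: D_def One_def numeral_eq_Suc)
  have H: "?pr [] (And (Forall ty1 (D (V 3 \<cdot> V 0))) (Forall ty1 (D (V 2 \<cdot> V 0))))"
    by (rule Hyp) (use wfD in auto)
  have instD: "inst (V 0) (D (V (Suc k) \<cdot> V 0)) = D (V k \<cdot> V 0)" for k
    by (simp add: D_def inst_def up_def lift_def One_def)
  have Da: "?pr [] (D ?a)"
    using ForallE[OF proves_conjD1[OF H wfD(3,4)], of "V 0"] instD[of 2] by (simp add: numeral_eq_Suc)
  have Db: "?pr [] (D ?b)"
    using ForallE[OF proves_conjD2[OF H wfD(3,4)], of "V 0"] instD[of 1] by (simp add: numeral_eq_Suc)
  have ab: "?pr [] (Imp ?P (Eq t Zero))" "?pr [] (Imp (Eq t Zero) ?P)" "?pr [] (Or (Eq t Zero) (Eq t One))"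
     if "?pr [] (D t)" "tyof Map.empty ?E t = Some N" for t
  proof -
    have w: "wf_fm Map.empty ?E (Iff ?P (Eq t Zero))" "wf_fm Map.empty ?E (Or (Eq t Zero) (Eq t One))"
      using that(2) by (simp_all add: One_def)
    have i: "?pr [] (Iff ?P (Eq t Zero))"
      by (rule proves_conjD1[OF _ w]) (use that(1) D_def in simp)
    show "?pr [] (Or (Eq t Zero) (Eq t One))"
      by (rule proves_conjD2[OF _ w]) (use that(1) D_def in simp)
    show "?pr [] (Imp ?P (Eq t Zero))" by (rule proves_conjD1[OF i]) (use w in auto)
    show "?pr [] (Imp (Eq t Zero) ?P)" by (rule proves_conjD2[OF i]) (use w in auto)
  qed
  have ta: "tyof Map.empty ?E ?a = Some N" and tb: "tyof Map.empty ?E ?b = Some N" by simp_all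
  have wf: "wf_fm Map.empty ?E (Eq x y)" if "x \<in> {?a, ?b, Zero, One}" "y \<in> {?a, ?b, Zero, One}" for x y
    using that by (auto simp: One_def)
  have join: "?pr H (Eq ?a ?b)" if 1: "?pr H (Eq ?a c)" and 2: "?pr H (Eq ?b c)" and "c \<in> {Zero, One}" for H c
  proof -
    have s: "?pr H (Eq c ?b)"
      by (rule ImpE[OF Axm[where Ax = RCA0_omega, OF Eq_sym] 2]) (use that(3) wf in auto)
    show ?thesis
      by (rule ImpE[OF ImpE[OF Axm[where Ax = RCA0_omega, OF Eq_trans] 1] s]) (use that(3) wf in auto)
  qed
  have "?pr [] (Eq ?a ?b)"
  proof (rule proves_cases[where A = ?P])
    have P: "?pr [?P] ?P" by (rule Hyp) auto
    have w: "?pr [] A \<Longrightarrow> ?pr [?P] A" for A by (erule proves_weaken) auto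
    have "?pr [?P] (Eq ?a ?b)"
      by (rule join[of _ Zero]) (use ImpE[OF w[OF ab(1)[OF Da ta]] P] ImpE[OF w[OF ab(1)[OF Db tb]] P] in auto)
    then show "proves Map.empty RCA0_omega ?E (?P # [] @ ?H) (Eq ?a ?b)" by simp
    have w': "?pr [] A \<Longrightarrow> ?pr (C # [Neg ?P]) A" "?pr [] A \<Longrightarrow> ?pr [Neg ?P] A" for A C
      by (erule proves_weaken; auto)+
    have one: "?pr [Neg ?P] (Eq t One)" if "?pr [] (D t)" "tyof Map.empty ?E t = Some N" for t
    proof (rule ImpE[OF w'(2)[OF ab(3)[OF that]]])
      have z: "?pr [Eq t Zero, Neg ?P] (Eq t Zero)" by (rule Hyp) (use that in auto)
      have "?pr [Eq t Zero, Neg ?P] (Neg ?P)" by (rule Hyp) auto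
      from ImpE[OF this ImpE[OF w'(1)[OF ab(2)[OF that]] z]]
      have "?pr [Eq t Zero, Neg ?P] Fls" .
      then have "proves Map.empty RCA0_omega ?E (Eq t Zero # [Neg ?P] @ ?H) Fls" by simp
      then show "?pr [Neg ?P] (Neg (Eq t Zero))" by (rule ImpI[rotated]) (use that in auto)
    qed
    have "?pr [Neg ?P] (Eq ?a ?b)"
      by (rule join[of _ One]) (use one[OF Da ta] one[OF Db tb] in auto)
    then show "proves Map.empty RCA0_omega ?E (Neg ?P # [] @ ?H) (Eq ?a ?b)" by simp
  qed auto
  then have main: "proves Map.empty RCA0_omega ?E ?H (Eq ?a ?b)" by simp
  have "proves Map.empty RCA0_omega [ty2, ty2]
      [And (inst (V 1) exists2_spec) (inst (V 0) exists2_spec)] (eq ty2 (V 1) (V 0))"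
    using ForallI[of Map.empty RCA0_omega ty1 "[ty2, ty2]"
        "[And (inst (V 1) exists2_spec) (inst (V 0) exists2_spec)]" "Eq ?a ?b"] main
    by (simp add: D_def exists2_spec_def inst_def liftf_def up_def lift_def One_def numeral_eq_Suc)
  then have "proves Map.empty RCA0_omega [ty2, ty2] []
      (Imp (And (inst (V 1) exists2_spec) (inst (V 0) exists2_spec)) (eq ty2 (V 1) (V 0)))"
    by (rule ImpI[rotated]) (simp add: exists2_spec_def inst_def up_def lift_def One_def)
  then have "proves Map.empty RCA0_omega [] [] (Forall ty2 (Forall ty2
      (Imp (And (inst (V 1) exists2_spec) (inst (V 0) exists2_spec)) (eq ty2 (V 1) (V 0)))))"
    by (auto intro!: ForallI simp del: eq.simps)
  then show ?thesis
    unfolding uniquely_specifies_def by (simp add: exists2_spec_def One_def)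
qed

lemma admissible_exists2: "admissible [0 \<mapsto> (ty2, exists2_spec)]"
  by (auto simp: admissible_def uniquely_specifies_exists2)

end

theory Submission
  imports Defs "HOL-Library.Countable"
begin

text \<open>
  The calculus is complete for Henkin models in which equality of every type is identity, so the
  equivalences may be argued in an arbitrary model of the axioms.

  \<open>(\<exists>\<^sup>2)\<close> yields, by \<open>QF-AC\<^sup>1\<^sup>,\<^sup>0\<close>, a search operator \<open>\<mu>\<close>. Its description has no parameters, so there is
  a standard one, and a standard function with a zero then has a standard zero. Conversely transfer
  and \<open>HAC\<^sub>i\<^sub>n\<^sub>t\<close> give a functional deciding the standard functions; it agrees on them with the constant
  for \<open>(\<exists>\<^sup>2)\<close>, to which parameter-free transfer applies. Separation for standard functions follows by
  deciding membership with a standard functional, and separating a set from itself refutes any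
  failure of transfer. Finally a uniform separating functional \<open>F\<close> is discontinuous at the constant
  function \<open>1\<close>, since \<open>F(h, 1, 0) \<noteq> F(1, h, 0)\<close> whenever \<open>h(\<cdot>, 0)\<close> has a zero; this makes the modulus
  obtained from extensionality and \<open>QF-AC\<^sup>1\<^sup>,\<^sup>0\<close> an unbounded search operator.
\<close>

text \<open>In a model the functionals of the argument come from combinatory completeness, and their
  equations serve as rewrite rules, whereas exhibiting them in the calculus would be laborious. The
  price is that the numbers of a model need not be the natural numbers: every fact used about
  predecessor, truncated subtraction and pairing has to be drawn from the recursor by
  quantifier-free induction. The obstacle is that transfer admits no parameters. A functional
  obtained by choice cannot be transferred as it stands: either the parameter is eliminated from its
  description, or a constant takes its place. One bounded search operator recurs in three places. It
  picks an entry of the finite sequence offered by \<open>HAC_int\<close>, it makes a nonstandard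
  zero visible at a pair code, and it turns a value of the modulus into a zero. It meets the coded
  sets through \<open>mon_pr\<close>: a pair code bounds its first component.\<close>

instance ty :: countable by countable_datatype
instance tm :: countable by countable_datatype
instance fm :: countable by countable_datatype

section \<open>Substitution\<close>

lemma lift_simps [simp]:
  "lift (V n) = V (Suc n)" "lift (Xi k) = Xi k" "lift Zero = Zero" "lift Sc = Sc"
  "lift (Comb_K \<sigma> \<tau>) = Comb_K \<sigma> \<tau>" "lift (Comb_S \<rho> \<sigma> \<tau>) = Comb_S \<rho> \<sigma> \<tau>" "lift Rec0 = Rec0"
  "lift (Len \<sigma>) = Len \<sigma>" "lift (Nth \<sigma>) = Nth \<sigma>" "lift (Tab \<sigma>) = Tab \<sigma>"
  "lift (s \<cdot> t) = lift s \<cdot> lift t"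
  by (simp_all add: lift_def)

lemma up_simps [simp]: "up \<theta> 0 = V 0" "up \<theta> (Suc n) = lift (\<theta> n)"
  by (simp_all add: up_def)

lemma up_eqI: "\<theta>' 0 = V 0 \<Longrightarrow> (\<And>n. \<theta>' (Suc n) = lift (\<theta> n)) \<Longrightarrow> \<theta>' = up \<theta>"
  by (rule ext) (simp add: up_def split: nat.split)

lemma sb_V [simp]: "sb V t = t"
  by (induction t) auto

lemma up_V [simp]: "up V = V"
  by (rule up_eqI[symmetric]) auto

lemma sbf_V [simp]: "sbf V A = A"
  by (induction A) auto

lemma sb_sb: "sb \<theta> (sb \<theta>' t) = sb (\<lambda>n. sb \<theta> (\<theta>' n)) t"
  by (induction t) auto

lemma sb_up_lift [simp]: "sb (up \<theta>) (lift t) = lift (sb \<theta> t)"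
  by (simp add: lift_def[abs_def] sb_sb up_def)

lemma sb_case_nat_lift [simp]: "sb (case_nat s \<theta>) (lift t) = sb \<theta> t"
  by (simp add: lift_def sb_sb)

lemma sbf_sbf: "sbf \<theta> (sbf \<theta>' A) = sbf (\<lambda>n. sb \<theta> (\<theta>' n)) A"
proof (induction A arbitrary: \<theta> \<theta>')
  case (Forall \<sigma> A)
  have "(\<lambda>n. sb (up \<theta>) (up \<theta>' n)) = up (\<lambda>n. sb \<theta> (\<theta>' n))"
    by (rule up_eqI) auto
  then show ?case by (simp add: Forall)
qed (simp_all add: sb_sb)

lemma inst_up: "inst t (sbf (up \<theta>) A) = sbf (case_nat t \<theta>) A"
proof -
  have "(\<lambda>n. sb (case_nat t V) (up \<theta> n)) = case_nat t \<theta>"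
    by (rule ext) (simp add: up_def split: nat.split)
  then show ?thesis by (simp add: inst_def sbf_sbf)
qed

lemma sbf_eq [simp]: "sbf \<theta> (eq \<tau> s t) = eq \<tau> (sb \<theta> s) (sb \<theta> t)"
  by (induction \<tau> arbitrary: \<theta> s t)
    (simp_all add: ForallLess_def lt_fm_def le_fm_def monus_tm_def iter_step_def pred_tm_def)

lemma inst_eq_app [simp]: "inst u (eq \<tau> (lift s \<cdot> V 0) (lift t \<cdot> V 0)) = eq \<tau> (s \<cdot> u) (t \<cdot> u)"
  by (simp add: inst_def)

section \<open>Typing\<close>

text \<open>New variables join a context at its far end, where they leave the existing indices
  untouched; weakening therefore needs no renaming.\<close>

lemma tyof_append: "tyof \<Sigma> E t = Some \<tau> \<Longrightarrow> tyof \<Sigma> (E @ E') t = Some \<tau>"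
  by (induction t arbitrary: \<tau>)
    (auto simp: nth_append split: if_splits option.splits ty.splits)

lemma wf_append: "wf_fm \<Sigma> E A \<Longrightarrow> wf_fm \<Sigma> (E @ E') A"
proof (induction A arbitrary: E)
  case (Forall \<sigma> A)
  then show ?case by (metis append_Cons wf_fm.simps(5))
qed (auto intro: tyof_append)

definition typed :: "sig \<Rightarrow> (nat \<Rightarrow> tm) \<Rightarrow> ty list \<Rightarrow> ty list \<Rightarrow> bool" where
  "typed \<Sigma> \<theta> E E' \<longleftrightarrow> (\<forall>n < length E. tyof \<Sigma> E' (\<theta> n) = Some (E ! n))"

lemma tyof_sb: "typed \<Sigma> \<theta> E E' \<Longrightarrow> tyof \<Sigma> E t = Some \<tau> \<Longrightarrow> tyof \<Sigma> E' (sb \<theta> t) = Some \<tau>"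
  by (induction t arbitrary: \<tau>)
    (auto simp: typed_def split: if_splits option.splits ty.splits)

lemma tyof_lift [simp]: "tyof \<Sigma> (\<sigma> # E) (lift t) = tyof \<Sigma> E t"
  by (induction t) (auto split: option.split ty.split)

lemma typed_up: "typed \<Sigma> \<theta> E E' \<Longrightarrow> typed \<Sigma> (up \<theta>) (\<sigma> # E) (\<sigma> # E')"
  by (auto simp: typed_def less_Suc_eq_0_disj)

lemma typed_case_nat:
  "typed \<Sigma> \<theta> E E' \<Longrightarrow> tyof \<Sigma> E' t = Some \<sigma> \<Longrightarrow> typed \<Sigma> (case_nat t \<theta>) (\<sigma> # E) E'"
  by (auto simp: typed_def less_Suc_eq_0_disj)

lemma typed_V: "typed \<Sigma> V E E"
  by (simp add: typed_def)

lemma wf_sbf: "typed \<Sigma> \<theta> E E' \<Longrightarrow> wf_fm \<Sigma> E A \<Longrightarrow> wf_fm \<Sigma> E' (sbf \<theta> A)"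
  by (induction A arbitrary: E E' \<theta>) (auto intro: tyof_sb typed_up)

lemma wf_inst: "wf_fm \<Sigma> (\<sigma> # E) A \<Longrightarrow> tyof \<Sigma> E t = Some \<sigma> \<Longrightarrow> wf_fm \<Sigma> E (inst t A)"
  unfolding inst_def by (rule wf_sbf[OF typed_case_nat[OF typed_V]])

lemma sb_cong_tyof:
  "tyof \<Sigma> E t = Some \<tau> \<Longrightarrow> (\<And>n. n < length E \<Longrightarrow> \<theta> n = \<theta>' n) \<Longrightarrow> sb \<theta> t = sb \<theta>' t"
  by (induction t arbitrary: \<tau>) (auto split: if_splits option.splits ty.splits)

lemma sbf_cong_wf:
  "wf_fm \<Sigma> E A \<Longrightarrow> (\<And>n. n < length E \<Longrightarrow> \<theta> n = \<theta>' n) \<Longrightarrow> sbf \<theta> A = sbf \<theta>' A"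
proof (induction A arbitrary: E \<theta> \<theta>')
  case (Forall \<sigma> A)
  have "sbf (up \<theta>) A = sbf (up \<theta>') A"
  proof (rule Forall.IH)
    show "wf_fm \<Sigma> (\<sigma> # E) A" using Forall.prems by simp
    show "up \<theta> n = up \<theta>' n" if "n < length (\<sigma> # E)" for n
      using that Forall.prems by (cases n) auto
  qed
  then show ?case by simp
next
  case (Imp A B)
  then have "sbf \<theta> A = sbf \<theta>' A" "sbf \<theta> B = sbf \<theta>' B" by (metis wf_fm.simps(4))+
  then show ?case by simp
qed (auto intro: sb_cong_tyof)

lemma tyof_zero_of [simp]: "tyof \<Sigma> E (zero_of \<tau>) = Some \<tau>"
  by (induction \<tau>) auto

lemma wf_eq: "tyof \<Sigma> E s = Some \<tau> \<Longrightarrow> tyof \<Sigma> E t = Some \<tau> \<Longrightarrow> wf_fm \<Sigma> E (eq \<tau> s t)"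
  by (induction \<tau> arbitrary: E s t)
    (simp_all add: ForallLess_def lt_fm_def le_fm_def monus_tm_def iter_step_def pred_tm_def)

section \<open>Admissibility of substitution\<close>

text \<open>No axiom rule inspects its context argument; typing is checked by \<open>Axm\<close>.
  Hence a derivation can be moved to a longer context.\<close>

lemma RCA0_omega_context: "RCA0_omega E A \<Longrightarrow> RCA0_omega E' A"
  by (induction rule: RCA0_omega.induct) (rule RCA0_omega.intros; assumption)+

lemma RCA0_Omega_context: "RCA0_Omega \<Sigma> E A \<Longrightarrow> RCA0_Omega \<Sigma> E' A"
  by (induction rule: RCA0_Omega.induct)
    (rule RCA0_Omega.intros; (assumption | erule RCA0_omega_context))+

abbreviation (input) derives :: "sig \<Rightarrow> ty list \<Rightarrow> fm list \<Rightarrow> fm \<Rightarrow> bool" where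
  "derives \<Sigma> \<equiv> proves \<Sigma> (RCA0_Omega \<Sigma>)"

lemma derives_append: "derives \<Sigma> E H A \<Longrightarrow> derives \<Sigma> (E @ E') H A"
proof (induction rule: proves.induct)
  case (Axm E A H)
  then show ?case by (blast intro: proves.Axm RCA0_Omega_context wf_append)
next
  case (ForallI \<sigma> E H A)
  then show ?case by (auto intro: proves.ForallI)
next
  case (ForallE E H \<sigma> A t)
  then show ?case by (blast intro: proves.ForallE tyof_append)
qed (blast intro: proves.intros wf_append)+

section \<open>Universal closures and substitution into derivations\<close>

primrec closure :: "ty list \<Rightarrow> fm \<Rightarrow> fm" where
  "closure [] A = A"
| "closure (\<sigma> # E) A = closure E (Forall \<sigma> A)"

primrec imps :: "fm list \<Rightarrow> fm \<Rightarrow> fm" where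
  "imps [] A = A"
| "imps (B # H) A = imps H (Imp B A)"

lemma derives_closure: "derives \<Sigma> E [] A \<Longrightarrow> derives \<Sigma> [] [] (closure E A)"
proof (induction E arbitrary: A)
  case (Cons \<sigma> E)
  then show ?case using ForallI[of \<Sigma> "RCA0_Omega \<Sigma>" \<sigma> E "[]" A] by auto
qed simp

lemma derives_imps: "derives \<Sigma> E (H @ H') A \<Longrightarrow> \<forall>B \<in> set H. wf_fm \<Sigma> E B \<Longrightarrow> derives \<Sigma> E H' (imps H A)"
  by (induction H arbitrary: A) (auto intro: ImpI)

lemma derives_impsD:
  "derives \<Sigma> E H' (imps H A) \<Longrightarrow> \<forall>B \<in> set H. derives \<Sigma> E H' B \<Longrightarrow> derives \<Sigma> E H' A"
  by (induction H arbitrary: A) (auto intro: ImpE)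

lemma sbf_imps: "sbf \<theta> (imps H A) = imps (map (sbf \<theta>) H) (sbf \<theta> A)"
  by (induction H arbitrary: A) auto

text \<open>An index beyond \<open>E\<close> refers to something outside the closure, so it drops by
  \<open>length E\<close> once the quantifiers are stripped.\<close>

lemma derives_closureD:
  assumes "derives \<Sigma> E' H (closure E A)" "typed \<Sigma> \<theta> E E'"
  shows "derives \<Sigma> E' H (sbf (\<lambda>n. if n < length E then \<theta> n else V (n - length E)) A)"
  using assms
proof (induction E arbitrary: A \<theta>)
  case (Cons \<sigma> E)
  let ?\<theta> = "\<lambda>n. if n < length E then \<theta> (Suc n) else V (n - length E)"
  have t: "tyof \<Sigma> E' (\<theta> 0) = Some \<sigma>" and "typed \<Sigma> (\<lambda>n. \<theta> (Suc n)) E E'"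
    using Cons.prems by (auto simp: typed_def)
  with Cons have "derives \<Sigma> E' H (Forall \<sigma> (sbf (up ?\<theta>) A))" by fastforce
  from ForallE[OF this t] have "derives \<Sigma> E' H (sbf (case_nat (\<theta> 0) ?\<theta>) A)"
    by (simp add: inst_up)
  moreover have "case_nat (\<theta> 0) ?\<theta> = (\<lambda>n. if n < length (\<sigma> # E) then \<theta> n else V (n - length (\<sigma> # E)))"
    by (auto split: nat.split)
  ultimately show ?case by simp
qed simp

text \<open>Passing through the universal closure avoids checking that every axiom scheme is closed
  under substitution.\<close>
lemma derives_sbf:
  assumes d: "derives \<Sigma> E H A" and H: "\<forall>B \<in> set H. wf_fm \<Sigma> E B" and A: "wf_fm \<Sigma> E A"
    and \<theta>: "typed \<Sigma> \<theta> E E'"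
  shows "derives \<Sigma> E' (map (sbf \<theta>) H) (sbf \<theta> A)"
proof -
  let ?\<theta> = "\<lambda>n. if n < length E then \<theta> n else V (n - length E)"
  have "derives \<Sigma> [] [] (closure E (imps H A))"
    by (rule derives_closure, rule derives_imps) (use d H in auto)
  from derives_append[OF this, of E'] have "derives \<Sigma> E' (map (sbf \<theta>) H) (closure E (imps H A))"
    by (auto intro: proves_weaken)
  from derives_closureD[OF this \<theta>]
  have "derives \<Sigma> E' (map (sbf \<theta>) H) (imps (map (sbf ?\<theta>) H) (sbf ?\<theta> A))"
    by (simp add: sbf_imps)
  moreover have "map (sbf ?\<theta>) H = map (sbf \<theta>) H"
    using H by (auto intro!: sbf_cong_wf[where \<Sigma> = \<Sigma> and E = E])
  moreover have "sbf ?\<theta> A = sbf \<theta> A"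
    by (rule sbf_cong_wf[OF A]) auto
  ultimately have "derives \<Sigma> E' (map (sbf \<theta>) H) (imps (map (sbf \<theta>) H) (sbf \<theta> A))" by simp
  then show ?thesis
    by (rule derives_impsD) (use H in \<open>auto intro!: Hyp wf_sbf[OF \<theta>]\<close>)
qed

text \<open>In the Henkin construction a derivation may use variables introduced after the fresh
  one, so \<open>ForallI\<close>, which binds index 0 only, does not apply directly.\<close>

lemma derives_generalize:
  assumes d: "derives \<Sigma> (E @ \<sigma> # E') H (inst (V (length E)) B)"
    and H: "\<forall>C \<in> set H. wf_fm \<Sigma> E C" and B: "wf_fm \<Sigma> (\<sigma> # E) B"
  shows "derives \<Sigma> E H (Forall \<sigma> B)"
proof (rule ForallI)
  let ?n = "length E"
  \<comment> \<open>The variable to be bound goes to index 0. The later ones, from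
    \<open>E'\<close>, occur in neither \<open>H\<close> nor \<open>B\<close> and are replaced by
    closed default terms.\<close>
  define \<theta> where "\<theta> = (\<lambda>k. if k < ?n then V (Suc k) else if k = ?n then V 0 else zero_of (E' ! (k - Suc ?n)))"
  have "typed \<Sigma> \<theta> (E @ \<sigma> # E') (\<sigma> # E)"
    by (auto simp: typed_def \<theta>_def nth_append nth_Cons' split: if_splits)
  moreover have "wf_fm \<Sigma> (E @ \<sigma> # E') (inst (V ?n) B)"
    by (rule wf_inst) (use wf_append[OF B] in auto)
  ultimately have *: "derives \<Sigma> (\<sigma> # E) (map (sbf \<theta>) H) (sbf \<theta> (inst (V ?n) B))"
    using d H by (auto intro!: derives_sbf wf_append)
  have "map (sbf \<theta>) H = map liftf H"
    unfolding liftf_def using H by (auto simp: \<theta>_def intro!: sbf_cong_wf[where \<Sigma> = \<Sigma> and E = E])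
  moreover have "sbf \<theta> (inst (V ?n) B) = B"
  proof -
    have "sbf \<theta> (inst (V ?n) B) = sbf V B"
      unfolding inst_def sbf_sbf
      by (rule sbf_cong_wf[OF B]) (auto simp: \<theta>_def less_Suc_eq_0_disj)
    then show ?thesis by simp
  qed
  ultimately show "derives \<Sigma> (\<sigma> # E) (map liftf H) B" using * by metis
qed

section \<open>Henkin sets\<close>

text \<open>The Henkin constants are the variables of one infinite context in which every type occurs
  infinitely often; \<open>ctx n\<close> are its finite initial segments.\<close>
definition var_ty :: "nat \<Rightarrow> ty" where
  "var_ty k = from_nat (fst (prod_decode k))"

definition ctx :: "nat \<Rightarrow> ty list" where
  "ctx n = map var_ty [0..<n]"

text \<open>The infinite context is not a list, so a typing over it means one over an initial
  segment; by weakening, finitely many typings always share a segment.\<close>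

definition has_ty :: "sig \<Rightarrow> tm \<Rightarrow> ty \<Rightarrow> bool" where
  "has_ty \<Sigma> t \<tau> \<longleftrightarrow> (\<exists>n. tyof \<Sigma> (ctx n) t = Some \<tau>)"

definition wff :: "sig \<Rightarrow> fm \<Rightarrow> bool" where
  "wff \<Sigma> A \<longleftrightarrow> (\<exists>n. wf_fm \<Sigma> (ctx n) A)"

lemma length_ctx [simp]: "length (ctx n) = n"
  by (simp add: ctx_def)

lemma nth_ctx [simp]: "k < n \<Longrightarrow> ctx n ! k = var_ty k"
  by (simp add: ctx_def)

lemma ctx_0 [simp]: "ctx 0 = []"
  by (simp add: ctx_def)

lemma var_ty_unbounded: "\<exists>c \<ge> m. var_ty c = \<sigma>"
  by (rule exI[of _ "prod_encode (to_nat \<sigma>, m)"]) (simp add: var_ty_def le_prod_encode_2)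

lemma ctx_extend: "n \<le> m \<Longrightarrow> \<exists>E. ctx m = ctx n @ E"
  unfolding ctx_def using upt_add_eq_append[of 0 n "m - n"] by auto

lemma ctx_split: "c < n \<Longrightarrow> \<exists>E. ctx n = ctx c @ var_ty c # E"
  using ctx_extend[of "Suc c" n] by (auto simp: ctx_def[of "Suc c"] ctx_def[of c])

lemma tyof_ctx_mono: "tyof \<Sigma> (ctx n) t = Some \<tau> \<Longrightarrow> n \<le> m \<Longrightarrow> tyof \<Sigma> (ctx m) t = Some \<tau>"
  using ctx_extend[of n m] tyof_append[of \<Sigma> "ctx n" t] by auto

lemma wf_ctx_mono: "wf_fm \<Sigma> (ctx n) A \<Longrightarrow> n \<le> m \<Longrightarrow> wf_fm \<Sigma> (ctx m) A"
  using ctx_extend[of n m] wf_append[of \<Sigma> "ctx n" A] by auto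

lemma derives_ctx_mono: "derives \<Sigma> (ctx n) H A \<Longrightarrow> n \<le> m \<Longrightarrow> derives \<Sigma> (ctx m) H A"
  using ctx_extend[of n m] derives_append[of \<Sigma> "ctx n" H A] by auto

lemma wff_list: "\<forall>B \<in> set H. wff \<Sigma> B \<Longrightarrow> \<exists>n. \<forall>B \<in> set H. wf_fm \<Sigma> (ctx n) B"
proof (induction H)
  case (Cons A H)
  then obtain n m where "\<forall>B \<in> set H. wf_fm \<Sigma> (ctx n) B" "wf_fm \<Sigma> (ctx m) A"
    by (auto simp: wff_def)
  then have "\<forall>B \<in> set (A # H). wf_fm \<Sigma> (ctx (max n m)) B"
    by (auto intro: wf_ctx_mono)
  then show ?case ..
qed simp

lemma has_ty_unique: "has_ty \<Sigma> t \<tau> \<Longrightarrow> has_ty \<Sigma> t \<tau>' \<Longrightarrow> \<tau> = \<tau>'"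
  unfolding has_ty_def by (metis nat_le_linear option.inject tyof_ctx_mono)

lemma has_ty_app: "has_ty \<Sigma> s (\<sigma> \<rightarrow> \<tau>) \<Longrightarrow> has_ty \<Sigma> t \<sigma> \<Longrightarrow> has_ty \<Sigma> (s \<cdot> t) \<tau>"
proof -
  assume "has_ty \<Sigma> s (\<sigma> \<rightarrow> \<tau>)" "has_ty \<Sigma> t \<sigma>"
  then obtain n m where "tyof \<Sigma> (ctx n) s = Some (\<sigma> \<rightarrow> \<tau>)" "tyof \<Sigma> (ctx m) t = Some \<sigma>"
    by (auto simp: has_ty_def)
  then have "tyof \<Sigma> (ctx (max n m)) (s \<cdot> t) = Some \<tau>"
    using tyof_ctx_mono[of \<Sigma> n s _ "max n m"] tyof_ctx_mono[of \<Sigma> m t _ "max n m"] by simp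
  then show ?thesis unfolding has_ty_def ..
qed

lemma has_ty_closed: "tyof \<Sigma> [] t = Some \<tau> \<Longrightarrow> has_ty \<Sigma> t \<tau>"
  unfolding has_ty_def by (rule exI[of _ 0]) simp

lemma has_ty_common:
  assumes "has_ty \<Sigma> s \<sigma>" "has_ty \<Sigma> t \<tau>"
  obtains n where "tyof \<Sigma> (ctx n) s = Some \<sigma>" "tyof \<Sigma> (ctx n) t = Some \<tau>"
proof -
  from assms obtain n m where "tyof \<Sigma> (ctx n) s = Some \<sigma>" "tyof \<Sigma> (ctx m) t = Some \<tau>"
    by (auto simp: has_ty_def)
  then show ?thesis
    by (intro that[of "max n m"]) (erule tyof_ctx_mono, simp)+
qed

lemma wff_Imp [simp]: "wff \<Sigma> (Imp A B) \<longleftrightarrow> wff \<Sigma> A \<and> wff \<Sigma> B"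
proof
  assume "wff \<Sigma> A \<and> wff \<Sigma> B"
  then obtain n where "\<forall>C \<in> set [A, B]. wf_fm \<Sigma> (ctx n) C"
    using wff_list[of "[A, B]" \<Sigma>] by auto
  then show "wff \<Sigma> (Imp A B)" by (auto simp: wff_def)
qed (auto simp: wff_def)

lemma wff_Fls [simp]: "wff \<Sigma> Fls"
  by (simp add: wff_def)

lemma wff_eq: "has_ty \<Sigma> s \<tau> \<Longrightarrow> has_ty \<Sigma> t \<tau> \<Longrightarrow> wff \<Sigma> (eq \<tau> s t)"
  by (erule (1) has_ty_common) (auto simp: wff_def intro: wf_eq)

lemma wff_Eq: "has_ty \<Sigma> s N \<Longrightarrow> has_ty \<Sigma> t N \<Longrightarrow> wff \<Sigma> (Eq s t)"
  using wff_eq[of \<Sigma> s N t] by simp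

lemma wff_St: "has_ty \<Sigma> t \<tau> \<Longrightarrow> wff \<Sigma> (St \<tau> t)"
  by (auto simp: wff_def has_ty_def)

lemma wf_mono_inst:
  assumes "wf_fm \<Sigma> (\<sigma> # ctx n) B" "has_ty \<Sigma> t \<sigma>" shows "wff \<Sigma> (inst t B)"
proof -
  obtain m where m: "tyof \<Sigma> (ctx m) t = Some \<sigma>" using assms(2) by (auto simp: has_ty_def)
  have "wf_fm \<Sigma> (ctx (max n m)) (Forall \<sigma> B)"
    by (rule wf_ctx_mono[of _ n]) (use assms(1) in auto)
  then have "wf_fm \<Sigma> (ctx (max n m)) (inst t B)"
    using tyof_ctx_mono[OF m, of "max n m"] by (auto intro: wf_inst)
  then show ?thesis unfolding wff_def ..
qed

lemma wff_inst: "wff \<Sigma> (Forall \<sigma> B) \<Longrightarrow> has_ty \<Sigma> t \<sigma> \<Longrightarrow> wff \<Sigma> (inst t B)"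
  unfolding wff_def[of _ "Forall \<sigma> B"] by (auto intro: wf_mono_inst)

lemma has_ty_V: "has_ty \<Sigma> (V c) (var_ty c)"
  unfolding has_ty_def by (rule exI[of _ "Suc c"]) simp

section \<open>Maximal consistent extension with witnesses\<close>

definition consistent :: "sig \<Rightarrow> fm list \<Rightarrow> bool" where
  "consistent \<Sigma> H \<longleftrightarrow> (\<forall>B \<in> set H. wff \<Sigma> B) \<and> (\<forall>n. \<not> derives \<Sigma> (ctx n) H Fls)"

text \<open>If \<open>A\<close> cannot be added, its negation can; a rejected universal formula also
  receives a variable as counterexample. Were that last addition inconsistent, the instance at a
  fresh variable would be derivable, and generalizing it would give \<open>A\<close> back.\<close>

lemma consistent_step:
  assumes H: "consistent \<Sigma> H" and A: "wff \<Sigma> A"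
  shows "\<exists>H'. consistent \<Sigma> H' \<and> set H \<subseteq> set H' \<and> (A \<in> set H' \<or> Neg A \<in> set H' \<and>
    (\<forall>\<sigma> B. A = Forall \<sigma> B \<longrightarrow> (\<exists>c. var_ty c = \<sigma> \<and> Neg (inst (V c) B) \<in> set H')))"
proof (cases "consistent \<Sigma> (A # H)")
  case True
  then show ?thesis by (intro exI[of _ "A # H"]) auto
next
  case False
  then obtain n where n: "derives \<Sigma> (ctx n) (A # H) Fls"
    using H A by (auto simp: consistent_def)
  obtain k where k: "wf_fm \<Sigma> (ctx k) A" using A by (auto simp: wff_def)
  have nA: "\<not> derives \<Sigma> (ctx m) (Neg A # H) Fls" for m
  proof
    assume m: "derives \<Sigma> (ctx m) (Neg A # H) Fls"
    let ?l = "max k (max n m)"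
    have wf: "wf_fm \<Sigma> (ctx ?l) A" by (rule wf_ctx_mono[OF k]) simp
    have "derives \<Sigma> (ctx ?l) H A"
      by (rule Classical[OF wf], rule derives_ctx_mono[OF m]) simp
    moreover have "derives \<Sigma> (ctx ?l) H (Neg A)"
      by (rule ImpI[OF wf], rule derives_ctx_mono[OF n]) simp
    ultimately have "derives \<Sigma> (ctx ?l) H Fls" by (rule ImpE[rotated])
    then show False using H by (auto simp: consistent_def)
  qed
  show ?thesis
  proof (cases "\<exists>\<sigma> B. A = Forall \<sigma> B")
    case False
    then show ?thesis using H A nA
      by (intro exI[of _ "Neg A # H"]) (auto simp: consistent_def)
  next
    case True
    then obtain \<sigma> B where AB: "A = Forall \<sigma> B" by blast
    have "\<forall>C \<in> set (Neg A # H). wff \<Sigma> C" using H A by (auto simp: consistent_def)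
    then obtain l where l: "\<forall>C \<in> set (Neg A # H). wf_fm \<Sigma> (ctx l) C"
      using wff_list by blast
    \<comment> \<open>From \<open>l\<close> on no variable occurs in a hypothesis, so
      \<open>V c\<close> is fresh, and \<open>ctx c\<close> types everything that the generalization
      must keep.\<close>
    obtain c where c: "l \<le> c" "var_ty c = \<sigma>" using var_ty_unbounded by blast
    have wfc: "\<forall>C \<in> set (Neg A # H). wf_fm \<Sigma> (ctx c) C"
      using l c wf_ctx_mono by blast
    have wi: "wff \<Sigma> (inst (V c) B)"
      using wff_inst has_ty_V[of \<Sigma> c] A AB c by metis
    then obtain j where j: "wf_fm \<Sigma> (ctx j) (inst (V c) B)" by (auto simp: wff_def)
    have "\<not> derives \<Sigma> (ctx m) (Neg (inst (V c) B) # Neg A # H) Fls" for m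
    proof
      assume m: "derives \<Sigma> (ctx m) (Neg (inst (V c) B) # Neg A # H) Fls"
      let ?l = "max j (max m (Suc c))"
      obtain E where E: "ctx ?l = ctx c @ var_ty c # E" using ctx_split[of c ?l] by (auto simp: less_max_iff_disj)
      have "derives \<Sigma> (ctx ?l) (Neg A # H) (inst (V c) B)"
        by (rule Classical, rule wf_ctx_mono[OF j], simp, rule derives_ctx_mono[OF m]) simp
      then have "derives \<Sigma> (ctx c @ \<sigma> # E) (Neg A # H) (inst (V (length (ctx c))) B)"
        using E c by simp
      then have "derives \<Sigma> (ctx c) (Neg A # H) A"
        unfolding AB by (rule derives_generalize) (use wfc AB in auto)
      moreover have "derives \<Sigma> (ctx c) (Neg A # H) (Neg A)"
        by (rule Hyp) (use wfc in auto)
      ultimately have "derives \<Sigma> (ctx c) (Neg A # H) Fls" by (rule ImpE[rotated])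
      then show False using nA by blast
    qed
    then show ?thesis using H A AB c wi
      by (intro exI[of _ "Neg (inst (V c) B) # Neg A # H"]) (auto simp: consistent_def)
  qed
qed

locale henkin_set =
  fixes \<Sigma> :: sig and S :: "fm set"
  assumes wff_mem: "A \<in> S \<Longrightarrow> wff \<Sigma> A"
    and not_refuted: "set H \<subseteq> S \<Longrightarrow> \<not> derives \<Sigma> (ctx n) H Fls"
    and complete: "wff \<Sigma> A \<Longrightarrow> A \<in> S \<or> Neg A \<in> S"
    and witness: "wff \<Sigma> (Forall \<sigma> B) \<Longrightarrow> Forall \<sigma> B \<notin> S \<Longrightarrow> \<exists>c. var_ty c = \<sigma> \<and> Neg (inst (V c) B) \<in> S"

text \<open>Formulas are countable, so a single run through them settles each one; a refutation uses
  finitely many members of the union, and these all lie in one stage.\<close>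

lemma henkin_set_exists:
  assumes "consistent \<Sigma> H0"
  obtains S where "henkin_set \<Sigma> S" "set H0 \<subseteq> S"
proof -
  define Q where "Q = (\<lambda>A H'. wff \<Sigma> A \<longrightarrow> A \<in> set H' \<or> Neg A \<in> set H' \<and>
    (\<forall>\<sigma> B. A = Forall \<sigma> B \<longrightarrow> (\<exists>c. var_ty c = \<sigma> \<and> Neg (inst (V c) B) \<in> set H')))"
  have step: "\<exists>H'. consistent \<Sigma> H' \<and> set H \<subseteq> set H' \<and> Q A H'" if "consistent \<Sigma> H" for H A
    using consistent_step[OF that, of A] that unfolding Q_def by (cases "wff \<Sigma> A") auto
  \<comment> \<open>Stage \<open>n\<close> treats the formula with code \<open>n\<close>;
    \<open>Q\<close> imposes nothing on ill-formed formulas.\<close>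
  have "\<exists>h. \<forall>n. (consistent \<Sigma> (h n) \<and> (n = 0 \<longrightarrow> h n = H0)) \<and>
      set (h n) \<subseteq> set (h (Suc n)) \<and> Q (from_nat n) (h (Suc n))"
    by (rule dependent_nat_choice) (use assms step in auto)
  then obtain h where h: "\<And>n. consistent \<Sigma> (h n)" "h 0 = H0" "\<And>n. set (h n) \<subseteq> set (h (Suc n))"
    "\<And>n. Q (from_nat n) (h (Suc n))" by blast
  define S where "S = (\<Union>n. set (h n))"
  have mono: "set (h n) \<subseteq> set (h m)" if "n \<le> m" for n m
    using lift_Suc_mono_le[of "\<lambda>n. set (h n)", OF h(3) that] .
  have fin: "\<exists>n. set H \<subseteq> set (h n)" if "set H \<subseteq> S" for H
    using that
  proof (induction H)
    case (Cons A H)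
    then obtain n m where "set H \<subseteq> set (h n)" "A \<in> set (h m)" by (auto simp: S_def)
    then have "set (A # H) \<subseteq> set (h (max n m))" using mono[of n "max n m"] mono[of m "max n m"] by auto
    then show ?case ..
  qed simp
  have Q: "\<exists>n. Q A (h n)" for A
    using h(4)[of "to_nat A"] by auto
  have cons: "\<not> derives \<Sigma> (ctx n) H Fls" if HS: "set H \<subseteq> S" for n H
  proof
    assume d: "derives \<Sigma> (ctx n) H Fls"
    obtain m where "set H \<subseteq> set (h m)" using fin[OF HS] ..
    from proves_weaken[OF d this] h(1)[of m] show False by (simp add: consistent_def)
  qed
  show ?thesis
  proof (rule that, unfold_locales)
    show "set H0 \<subseteq> S" using h(2) by (auto simp: S_def)
    show "wff \<Sigma> A" if "A \<in> S" for A using that h(1) by (auto simp: S_def consistent_def)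
    show "\<not> derives \<Sigma> (ctx n) H Fls" if "set H \<subseteq> S" for n H using cons[OF that] .
    show "A \<in> S \<or> Neg A \<in> S" if "wff \<Sigma> A" for A
      using Q[of A] that unfolding Q_def S_def by blast
    show "\<exists>c. var_ty c = \<sigma> \<and> Neg (inst (V c) B) \<in> S"
      if "wff \<Sigma> (Forall \<sigma> B)" "Forall \<sigma> B \<notin> S" for \<sigma> B
      using Q[of "Forall \<sigma> B"] that unfolding Q_def S_def by blast
  qed
qed

context henkin_set
begin

lemma derivable_mem:
  assumes "set H \<subseteq> S" "derives \<Sigma> (ctx n) H A" "wff \<Sigma> A" shows "A \<in> S"
proof (rule ccontr)
  assume "A \<notin> S"
  with complete assms have nA: "Neg A \<in> S" by blast
  obtain m where m: "wf_fm \<Sigma> (ctx m) A" using assms by (auto simp: wff_def)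
  let ?l = "max n m"
  have "derives \<Sigma> (ctx ?l) (Neg A # H) A"
    by (rule proves_weaken[OF derives_ctx_mono[OF assms(2)]]) auto
  moreover have "derives \<Sigma> (ctx ?l) (Neg A # H) (Neg A)"
    by (rule Hyp) (use wf_ctx_mono[OF m] in auto)
  ultimately have "derives \<Sigma> (ctx ?l) (Neg A # H) Fls" by (rule ImpE[rotated])
  then show False using not_refuted[of "Neg A # H"] nA assms by auto
qed

lemma axiom_mem:
  assumes "RCA0_Omega \<Sigma> E A" "wff \<Sigma> A" shows "A \<in> S"
proof -
  obtain n where "wf_fm \<Sigma> (ctx n) A" using assms(2) by (auto simp: wff_def)
  then have "derives \<Sigma> (ctx n) [] A" by (rule Axm[where Ax = "RCA0_Omega \<Sigma>", OF RCA0_Omega_context[OF assms(1)]])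
  then show ?thesis by (rule derivable_mem[rotated]) (use assms in auto)
qed

lemma Fls_mem [simp]: "Fls \<notin> S"
  using not_refuted[of "[Fls]" 0] by (auto intro!: Hyp)

lemma mp_mem: "Imp A B \<in> S \<Longrightarrow> A \<in> S \<Longrightarrow> B \<in> S"
proof -
  assume I: "Imp A B \<in> S" and A: "A \<in> S"
  obtain n where n: "wf_fm \<Sigma> (ctx n) (Imp A B)" using wff_mem[OF I] by (auto simp: wff_def)
  have "derives \<Sigma> (ctx n) [Imp A B, A] B"
    by (rule ImpE[of _ _ _ _ A]) (use n in \<open>auto intro!: Hyp\<close>)
  then show "B \<in> S" by (rule derivable_mem[rotated]) (use I A wff_mem[OF I] in auto)
qed

lemma Imp_mem [simp]:
  assumes "wff \<Sigma> A" "wff \<Sigma> B" shows "Imp A B \<in> S \<longleftrightarrow> (A \<in> S \<longrightarrow> B \<in> S)"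
proof
  assume imp: "A \<in> S \<longrightarrow> B \<in> S"
  have "wff \<Sigma> (Imp A B)" using assms by simp
  then obtain n where n: "wf_fm \<Sigma> (ctx n) (Imp A B)" unfolding wff_def by blast
  show "Imp A B \<in> S"
  proof (cases "A \<in> S")
    case True
    have "derives \<Sigma> (ctx n) [B] (Imp A B)" by (rule ImpI) (use n in \<open>auto intro!: Hyp\<close>)
    then show ?thesis by (rule derivable_mem[rotated]) (use True imp assms in auto)
  next
    case False
    then have nA: "Neg A \<in> S" using complete assms by blast
    have "derives \<Sigma> (ctx n) [Neg B, A, Neg A] Fls"
      by (rule ImpE[of _ _ _ _ A]) (use n in \<open>auto intro!: Hyp\<close>)
    then have "derives \<Sigma> (ctx n) [Neg A] (Imp A B)"
      by (rule ImpI[OF _ Classical, rotated 2]) (use n in auto)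
    then show ?thesis by (rule derivable_mem[rotated]) (use nA assms in auto)
  qed
qed (use mp_mem in blast)

lemma Forall_mem:
  assumes "wff \<Sigma> (Forall \<sigma> A)"
  shows "Forall \<sigma> A \<in> S \<longleftrightarrow> (\<forall>t. has_ty \<Sigma> t \<sigma> \<longrightarrow> inst t A \<in> S)"
proof (intro iffI allI impI)
  fix t assume F: "Forall \<sigma> A \<in> S" and t: "has_ty \<Sigma> t \<sigma>"
  obtain n m where n: "wf_fm \<Sigma> (ctx n) (Forall \<sigma> A)" and m: "tyof \<Sigma> (ctx m) t = Some \<sigma>"
    using assms t by (auto simp: wff_def has_ty_def)
  have "derives \<Sigma> (ctx (max n m)) [Forall \<sigma> A] (inst t A)"
    by (rule ForallE[OF Hyp]) (use wf_ctx_mono[OF n] tyof_ctx_mono[OF m] in auto)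
  then show "inst t A \<in> S" by (rule derivable_mem[rotated]) (use F wff_inst[OF assms t] in auto)
next
  assume all: "\<forall>t. has_ty \<Sigma> t \<sigma> \<longrightarrow> inst t A \<in> S"
  show "Forall \<sigma> A \<in> S"
  proof (rule ccontr)
    assume "Forall \<sigma> A \<notin> S"
    then obtain c where c: "var_ty c = \<sigma>" "Neg (inst (V c) A) \<in> S" using witness assms by blast
    then have "inst (V c) A \<in> S" using all has_ty_V by blast
    from mp_mem[OF c(2) this] show False by simp
  qed
qed

end

section \<open>Models\<close>

text \<open>All types live in one carrier, cut into domains by \<open>D\<close>, so that a single
  application and a single evaluation serve every type.\<close>

locale interp =
  fixes D :: "ty \<Rightarrow> 'a set" and ap :: "'a \<Rightarrow> 'a \<Rightarrow> 'a" (infixl "\<bullet>" 90)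
    and cst :: "tm \<Rightarrow> 'a" and st :: "ty \<Rightarrow> 'a set"
begin

primrec ev :: "'a list \<Rightarrow> tm \<Rightarrow> 'a" where
  "ev xs (V n) = xs ! n"
| "ev xs (Xi k) = cst (Xi k)"
| "ev xs Zero = cst Zero"
| "ev xs Sc = cst Sc"
| "ev xs (Comb_K \<sigma> \<tau>) = cst (Comb_K \<sigma> \<tau>)"
| "ev xs (Comb_S \<rho> \<sigma> \<tau>) = cst (Comb_S \<rho> \<sigma> \<tau>)"
| "ev xs Rec0 = cst Rec0"
| "ev xs (Len \<sigma>) = cst (Len \<sigma>)"
| "ev xs (Nth \<sigma>) = cst (Nth \<sigma>)"
| "ev xs (Tab \<sigma>) = cst (Tab \<sigma>)"
| "ev xs (s \<cdot> t) = ev xs s \<bullet> ev xs t"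

primrec sat :: "'a list \<Rightarrow> fm \<Rightarrow> bool" where
  "sat xs (Eq s t) \<longleftrightarrow> ev xs s = ev xs t"
| "sat xs (St \<tau> t) \<longleftrightarrow> ev xs t \<in> st \<tau>"
| "sat xs Fls \<longleftrightarrow> False"
| "sat xs (Imp A B) \<longleftrightarrow> (sat xs A \<longrightarrow> sat xs B)"
| "sat xs (Forall \<sigma> A) \<longleftrightarrow> (\<forall>x \<in> D \<sigma>. sat (x # xs) A)"

abbreviation env :: "'a list \<Rightarrow> ty list \<Rightarrow> bool" where
  "env \<equiv> list_all2 (\<lambda>x \<sigma>. x \<in> D \<sigma>)"

end

text \<open>\<open>sat_eq\<close> makes equality of every finite type true identity, so models are extensional.\<close>
locale model = interp D ap cst st
  for \<Sigma> :: sig and D :: "ty \<Rightarrow> 'a set" and ap :: "'a \<Rightarrow> 'a \<Rightarrow> 'a" (infixl "\<bullet>" 90)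
    and cst :: "tm \<Rightarrow> 'a" and st :: "ty \<Rightarrow> 'a set" +
  assumes ev_in: "tyof \<Sigma> E t = Some \<tau> \<Longrightarrow> env xs E \<Longrightarrow> ev xs t \<in> D \<tau>"
    and sat_axiom: "RCA0_Omega \<Sigma> E A \<Longrightarrow> wf_fm \<Sigma> E A \<Longrightarrow> env xs E \<Longrightarrow> sat xs A"
    and sat_eq: "tyof \<Sigma> E s = Some \<tau> \<Longrightarrow> tyof \<Sigma> E t = Some \<tau> \<Longrightarrow> env xs E \<Longrightarrow>
      sat xs (eq \<tau> s t) \<longleftrightarrow> ev xs s = ev xs t"
    and st_subset: "st \<tau> \<subseteq> D \<tau>"

section \<open>The term model of a Henkin set\<close>

context henkin_set
begin

abbreviation ht :: "tm \<Rightarrow> ty \<Rightarrow> bool" where "ht \<equiv> has_ty \<Sigma>"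

section \<open>Equality formulas in \<open>S\<close> as a congruence\<close>

definition R :: "ty \<Rightarrow> tm \<Rightarrow> tm \<Rightarrow> bool" where
  "R \<tau> s t \<longleftrightarrow> eq \<tau> s t \<in> S"

lemma And_mem: "wff \<Sigma> A \<Longrightarrow> wff \<Sigma> B \<Longrightarrow> And A B \<in> S \<longleftrightarrow> A \<in> S \<and> B \<in> S"
  by simp

lemma R_N: "R N s t \<longleftrightarrow> Eq s t \<in> S"
  by (simp add: R_def)

lemma R_fun:
  assumes "ht s (\<sigma> \<rightarrow> \<tau>)" "ht t (\<sigma> \<rightarrow> \<tau>)"
  shows "R (\<sigma> \<rightarrow> \<tau>) s t \<longleftrightarrow> (\<forall>u. ht u \<sigma> \<longrightarrow> R \<tau> (s \<cdot> u) (t \<cdot> u))"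
  using Forall_mem[of \<sigma> "eq \<tau> (lift s \<cdot> V 0) (lift t \<cdot> V 0)"] wff_eq[OF assms]
  by (simp add: R_def)

lemma has_ty_consts: "ht Zero N" "ht Sc (N \<rightarrow> N)" "ht Rec0 (N \<rightarrow> N \<rightarrow> (N \<rightarrow> N \<rightarrow> N) \<rightarrow> N)"
  "ht (Len \<sigma>) (Star \<sigma> \<rightarrow> N)" "ht (Nth \<sigma>) (Star \<sigma> \<rightarrow> N \<rightarrow> \<sigma>)"
  "ht (iter_step pred_tm) (N \<rightarrow> N \<rightarrow> N)"
  by (auto intro!: has_ty_closed simp: iter_step_def pred_tm_def)

lemma has_ty_Len: "ht s (Star \<sigma>) \<Longrightarrow> ht (Len \<sigma> \<cdot> s) N"
  using has_ty_consts has_ty_app by blast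

lemma has_ty_Nth: "ht s (Star \<sigma>) \<Longrightarrow> ht i N \<Longrightarrow> ht (Nth \<sigma> \<cdot> s \<cdot> i) \<sigma>"
  using has_ty_consts has_ty_app by blast

lemma has_ty_monus: "ht s N \<Longrightarrow> ht t N \<Longrightarrow> ht (monus_tm s t) N"
  unfolding monus_tm_def using has_ty_consts has_ty_app by blast

lemma wff_lt: "ht i N \<Longrightarrow> ht l N \<Longrightarrow> wff \<Sigma> (lt_fm i l)"
  unfolding lt_fm_def le_fm_def by (intro wff_Eq has_ty_monus has_ty_app[OF has_ty_consts(2)] has_ty_consts(1))

lemma R_Star:
  assumes "ht s (Star \<sigma>)" "ht t (Star \<sigma>)"
  shows "R (Star \<sigma>) s t \<longleftrightarrow> Eq (Len \<sigma> \<cdot> s) (Len \<sigma> \<cdot> t) \<in> S \<and>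
    (\<forall>i. ht i N \<longrightarrow> lt_fm i (Len \<sigma> \<cdot> s) \<in> S \<longrightarrow> R \<sigma> (Nth \<sigma> \<cdot> s \<cdot> i) (Nth \<sigma> \<cdot> t \<cdot> i))"
proof -
  let ?B = "Imp (lt_fm (V 0) (lift (Len \<sigma> \<cdot> s))) (eq \<sigma> (Nth \<sigma> \<cdot> lift s \<cdot> V 0) (Nth \<sigma> \<cdot> lift t \<cdot> V 0))"
  have w: "wff \<Sigma> (Eq (Len \<sigma> \<cdot> s) (Len \<sigma> \<cdot> t))" "wff \<Sigma> (Forall N ?B)"
    using wff_eq[OF assms] by (simp_all add: ForallLess_def)
  have "inst i ?B = Imp (lt_fm i (Len \<sigma> \<cdot> s)) (eq \<sigma> (Nth \<sigma> \<cdot> s \<cdot> i) (Nth \<sigma> \<cdot> t \<cdot> i))" for i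
    by (simp add: inst_def lt_fm_def le_fm_def monus_tm_def iter_step_def pred_tm_def)
  moreover have "wff \<Sigma> (lt_fm i (Len \<sigma> \<cdot> s))" "wff \<Sigma> (eq \<sigma> (Nth \<sigma> \<cdot> s \<cdot> i) (Nth \<sigma> \<cdot> t \<cdot> i))" if "ht i N" for i
    using that assms by (auto intro!: wff_lt wff_eq has_ty_Len has_ty_Nth)
  ultimately have "Forall N ?B \<in> S \<longleftrightarrow>
    (\<forall>i. ht i N \<longrightarrow> lt_fm i (Len \<sigma> \<cdot> s) \<in> S \<longrightarrow> R \<sigma> (Nth \<sigma> \<cdot> s \<cdot> i) (Nth \<sigma> \<cdot> t \<cdot> i))"
    unfolding Forall_mem[OF w(2)] by (simp add: R_def)
  moreover have "R (Star \<sigma>) s t \<longleftrightarrow> Eq (Len \<sigma> \<cdot> s) (Len \<sigma> \<cdot> t) \<in> S \<and> Forall N ?B \<in> S"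
    unfolding R_def eq.simps ForallLess_def by (rule And_mem[OF w])
  ultimately show ?thesis by simp
qed

lemma base_axiom_mem: "RCA0_omega [] A \<Longrightarrow> wff \<Sigma> A \<Longrightarrow> A \<in> S"
  using axiom_mem base by blast

lemma Eq_refl_mem: "ht s N \<Longrightarrow> Eq s s \<in> S"
  by (intro base_axiom_mem RCA0_omega.Eq_refl wff_Eq)

lemma Eq_sym_mem: "Eq s t \<in> S \<Longrightarrow> ht s N \<Longrightarrow> ht t N \<Longrightarrow> Eq t s \<in> S"
  using base_axiom_mem[OF Eq_sym[of _ s t]] mp_mem by (simp add: wff_Eq)

lemma Eq_trans_mem: "Eq s t \<in> S \<Longrightarrow> Eq t u \<in> S \<Longrightarrow> ht s N \<Longrightarrow> ht t N \<Longrightarrow> ht u N \<Longrightarrow> Eq s u \<in> S"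
  using base_axiom_mem[OF Eq_trans[of _ s t u]] mp_mem by (simp add: wff_Eq)

lemma R_arg:
  assumes "R \<sigma> s t" "ht f (\<sigma> \<rightarrow> \<tau>)" "ht s \<sigma>" "ht t \<sigma>" shows "R \<tau> (f \<cdot> s) (f \<cdot> t)"
proof -
  have "Imp (eq \<sigma> s t) (eq \<tau> (f \<cdot> s) (f \<cdot> t)) \<in> S"
    by (intro base_axiom_mem extensionality)
      (use assms in \<open>auto intro!: wff_eq intro: has_ty_app\<close>)
  then show ?thesis using mp_mem assms(1) by (auto simp: R_def)
qed

lemma R_fun_app: "R (\<sigma> \<rightarrow> \<tau>) s t \<Longrightarrow> ht s (\<sigma> \<rightarrow> \<tau>) \<Longrightarrow> ht t (\<sigma> \<rightarrow> \<tau>) \<Longrightarrow> ht u \<sigma> \<Longrightarrow> R \<tau> (s \<cdot> u) (t \<cdot> u)"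
  using R_fun by blast

text \<open>\<open>R\<close> at a sequence type bounds the index by the length of its left argument
  only. Symmetry and transitivity need the bound moved to the other length, which is done by
  following the equation through the recursor in \<open>monus_tm\<close>.\<close>

lemma lt_mem_cong:
  assumes "lt_fm i l \<in> S" "Eq l l' \<in> S" "ht i N" "ht l N" "ht l' N" shows "lt_fm i l' \<in> S"
proof -
  note ty = has_ty_app[OF has_ty_consts(3)] has_ty_app[OF has_ty_app[OF has_ty_consts(3)]]
  have i: "ht (Sc \<cdot> i) N" using assms(3) has_ty_consts has_ty_app by blast
  have "R (N \<rightarrow> (N \<rightarrow> N \<rightarrow> N) \<rightarrow> N) (Rec0 \<cdot> l') (Rec0 \<cdot> l)"
    by (rule R_arg[OF _ has_ty_consts(3)]) (use assms in \<open>auto simp: R_N intro: Eq_sym_mem\<close>)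
  from R_fun_app[OF this ty(1)[OF assms(5)] ty(1)[OF assms(4)] i]
  have "R ((N \<rightarrow> N \<rightarrow> N) \<rightarrow> N) (Rec0 \<cdot> l' \<cdot> (Sc \<cdot> i)) (Rec0 \<cdot> l \<cdot> (Sc \<cdot> i))" .
  from R_fun_app[OF this ty(2)[OF assms(5) i] ty(2)[OF assms(4) i] has_ty_consts(6)]
  have "Eq (monus_tm (Sc \<cdot> i) l') (monus_tm (Sc \<cdot> i) l) \<in> S" by (simp add: R_N monus_tm_def)
  from Eq_trans_mem[OF this] show ?thesis
    using assms i unfolding lt_fm_def le_fm_def by (simp add: has_ty_monus has_ty_consts)
qed

lemma R_refl: "ht s \<tau> \<Longrightarrow> R \<tau> s s"
  by (induction \<tau> arbitrary: s)
    (auto simp: R_N R_fun R_Star intro: Eq_refl_mem has_ty_app has_ty_Len has_ty_Nth)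

lemma R_sym: "R \<tau> s t \<Longrightarrow> ht s \<tau> \<Longrightarrow> ht t \<tau> \<Longrightarrow> R \<tau> t s"
proof (induction \<tau> arbitrary: s t)
  case N
  then show ?case by (auto simp: R_N intro: Eq_sym_mem)
next
  case (Arr \<sigma> \<tau>)
  have "R \<tau> (t \<cdot> u) (s \<cdot> u)" if "ht u \<sigma>" for u
    by (rule Arr.IH(2)) (use Arr.prems that in \<open>auto intro: has_ty_app R_fun_app\<close>)
  then show ?case using Arr.prems by (simp add: R_fun)
next
  case (Star \<sigma>)
  have e: "Eq (Len \<sigma> \<cdot> t) (Len \<sigma> \<cdot> s) \<in> S"
    using Star.prems by (auto simp: R_Star intro: Eq_sym_mem has_ty_Len)
  have "R \<sigma> (Nth \<sigma> \<cdot> t \<cdot> i) (Nth \<sigma> \<cdot> s \<cdot> i)" if i: "ht i N" "lt_fm i (Len \<sigma> \<cdot> t) \<in> S" for i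
    using lt_mem_cong[OF i(2) e] i Star by (simp add: R_Star has_ty_Len has_ty_Nth)
  then show ?case using e Star.prems by (simp add: R_Star)
qed

lemma R_trans: "R \<tau> s t \<Longrightarrow> R \<tau> t u \<Longrightarrow> ht s \<tau> \<Longrightarrow> ht t \<tau> \<Longrightarrow> ht u \<tau> \<Longrightarrow> R \<tau> s u"
proof (induction \<tau> arbitrary: s t u)
  case N
  then show ?case by (auto simp: R_N intro: Eq_trans_mem)
next
  case (Arr \<sigma> \<tau>)
  have "R \<tau> (s \<cdot> v) (u \<cdot> v)" if "ht v \<sigma>" for v
    by (rule Arr.IH(2)[of _ "t \<cdot> v"]) (use Arr.prems that in \<open>auto intro: has_ty_app R_fun_app\<close>)
  then show ?case using Arr.prems by (simp add: R_fun)
next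
  case (Star \<sigma>)
  have e: "Eq (Len \<sigma> \<cdot> s) (Len \<sigma> \<cdot> t) \<in> S" and e': "Eq (Len \<sigma> \<cdot> s) (Len \<sigma> \<cdot> u) \<in> S"
    using Star.prems by (auto simp: R_Star intro: Eq_trans_mem has_ty_Len)
  have "R \<sigma> (Nth \<sigma> \<cdot> s \<cdot> i) (Nth \<sigma> \<cdot> u \<cdot> i)" if i: "ht i N" "lt_fm i (Len \<sigma> \<cdot> s) \<in> S" for i
  proof (rule Star.IH)
    show "R \<sigma> (Nth \<sigma> \<cdot> s \<cdot> i) (Nth \<sigma> \<cdot> t \<cdot> i)" using Star.prems i by (simp add: R_Star)
    show "R \<sigma> (Nth \<sigma> \<cdot> t \<cdot> i) (Nth \<sigma> \<cdot> u \<cdot> i)"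
      using lt_mem_cong[OF i(2) e] i Star.prems by (simp add: R_Star has_ty_Len)
  qed (use Star.prems i in \<open>auto intro: has_ty_Nth\<close>)
  then show ?case using e' Star.prems by (simp add: R_Star)
qed

lemma R_app:
  assumes "R (\<sigma> \<rightarrow> \<tau>) f g" "R \<sigma> s t" "ht f (\<sigma> \<rightarrow> \<tau>)" "ht g (\<sigma> \<rightarrow> \<tau>)" "ht s \<sigma>" "ht t \<sigma>"
  shows "R \<tau> (f \<cdot> s) (g \<cdot> t)"
  by (rule R_trans[OF R_fun_app[OF assms(1)] R_arg[OF assms(2)]])
    (use assms in \<open>auto intro: has_ty_app\<close>)

section \<open>Representatives of the classes and the truth lemma\<close>

definition nf :: "tm \<Rightarrow> tm" where
  "nf t = (SOME s. \<exists>\<tau>. ht t \<tau> \<and> ht s \<tau> \<and> R \<tau> t s)"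

lemma nf_props:
  assumes "ht t \<tau>" shows "ht (nf t) \<tau>" "R \<tau> t (nf t)"
proof -
  have "\<exists>\<tau>. ht t \<tau> \<and> ht (nf t) \<tau> \<and> R \<tau> t (nf t)"
    unfolding nf_def by (rule someI[of _ t]) (use assms R_refl in blast)
  then show "ht (nf t) \<tau>" "R \<tau> t (nf t)" using has_ty_unique assms by blast+
qed

text \<open>Terms related by \<open>R\<close> have the same candidates under the choice in
  \<open>nf\<close>, so the same one is picked. The existential over types lets \<open>nf\<close>
  depend on the term alone, whose type is unique.\<close>

lemma nf_eq_iff:
  assumes s: "ht s \<tau>" and t: "ht t \<tau>" shows "nf s = nf t \<longleftrightarrow> R \<tau> s t"
proof
  assume "nf s = nf t"
  then show "R \<tau> s t" using R_trans[OF nf_props(2)[OF s]] R_sym[OF nf_props(2)[OF t]] nf_props(1) s t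
    by simp
next
  assume st: "R \<tau> s t"
  have "(\<exists>\<rho>. ht s \<rho> \<and> ht u \<rho> \<and> R \<rho> s u) \<longleftrightarrow> (\<exists>\<rho>. ht t \<rho> \<and> ht u \<rho> \<and> R \<rho> t u)" for u
    using has_ty_unique[of \<Sigma> s \<tau>] has_ty_unique[of \<Sigma> t \<tau>] s t R_trans[OF st] R_trans[OF R_sym[OF st s t]]
    by metis
  then show "nf s = nf t" by (simp add: nf_def)
qed

lemma nf_app:
  assumes "ht f (\<sigma> \<rightarrow> \<tau>)" "ht t \<sigma>" shows "nf (nf f \<cdot> nf t) = nf (f \<cdot> t)"
proof -
  have "R \<tau> (f \<cdot> t) (nf f \<cdot> nf t)"
    by (rule R_app) (use assms nf_props in auto)
  then show ?thesis
    using nf_eq_iff[of "f \<cdot> t" \<tau> "nf f \<cdot> nf t"] assms nf_props(1) has_ty_app by metis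
qed

definition DD :: "ty \<Rightarrow> tm set" where "DD \<tau> = nf ` {t. ht t \<tau>}"
definition SS :: "ty \<Rightarrow> tm set" where "SS \<tau> = nf ` {t. ht t \<tau> \<and> St \<tau> t \<in> S}"

interpretation M: interp DD "\<lambda>s t. nf (s \<cdot> t)" nf SS .

lemma nth_case_nat: "case_nat x ((!) xs) = (!) (x # xs)"
  by (rule ext) (simp split: nat.split)

lemma env_typed:
  "list_all2 ht ts E \<Longrightarrow> \<exists>n. typed \<Sigma> ((!) ts) E (ctx n)"
proof (induction rule: list_all2_induct)
  case (Cons t ts \<sigma> E)
  then obtain n m where n: "typed \<Sigma> ((!) ts) E (ctx n)" and m: "tyof \<Sigma> (ctx m) t = Some \<sigma>"
    by (auto simp: has_ty_def)
  have "typed \<Sigma> ((!) ts) E (ctx (max n m))" "tyof \<Sigma> (ctx (max n m)) t = Some \<sigma>"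
    using n tyof_ctx_mono[OF m] by (auto simp: typed_def intro: tyof_ctx_mono)
  from typed_case_nat[OF this] show ?case unfolding nth_case_nat ..
qed (simp add: typed_def)

lemma has_ty_sb: "list_all2 ht ts E \<Longrightarrow> tyof \<Sigma> E t = Some \<tau> \<Longrightarrow> ht (sb ((!) ts) t) \<tau>"
  using env_typed tyof_sb unfolding has_ty_def by blast

lemma wff_sbf: "list_all2 ht ts E \<Longrightarrow> wf_fm \<Sigma> E A \<Longrightarrow> wff \<Sigma> (sbf ((!) ts) A)"
  using env_typed wf_sbf unfolding wff_def by blast

lemma ev_nf: "list_all2 ht ts E \<Longrightarrow> tyof \<Sigma> E t = Some \<tau> \<Longrightarrow> M.ev (map nf ts) t = nf (sb ((!) ts) t)"
proof (induction t arbitrary: \<tau>)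
  case (V n)
  then show ?case by (auto simp: list_all2_lengthD split: if_splits)
next
  case (App s t)
  then obtain \<sigma> where "tyof \<Sigma> E s = Some (\<sigma> \<rightarrow> \<tau>)" "tyof \<Sigma> E t = Some \<sigma>"
    by (auto split: option.splits ty.splits if_splits)
  then show ?case using App nf_app[OF has_ty_sb has_ty_sb] by simp
qed auto

text \<open>This makes membership in \<open>SS\<close> independent of the representative.\<close>

lemma St_mem_cong:
  assumes "R \<tau> s t" "St \<tau> s \<in> S" "ht s \<tau>" "ht t \<tau>" shows "St \<tau> t \<in> S"
proof -
  have "Imp (And (St \<tau> s) (eq \<tau> s t)) (St \<tau> t) \<in> S"
    by (rule axiom_mem[OF st_eq[of _ "[]"]]) (use assms in \<open>auto simp: wff_St wff_eq\<close>)
  then show ?thesis using assms by (simp add: wff_St wff_eq R_def)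
qed

text \<open>Every element of \<open>DD\<close> is the class of a term, so a quantifier over a domain
  is one over terms, which \<open>Forall_mem\<close> reduces to the Henkin witnesses.\<close>

lemma truth:
  "list_all2 ht ts E \<Longrightarrow> wf_fm \<Sigma> E A \<Longrightarrow> M.sat (map nf ts) A \<longleftrightarrow> sbf ((!) ts) A \<in> S"
proof (induction A arbitrary: ts E)
  case (Eq s t)
  then show ?case using ev_nf nf_eq_iff[of "sb ((!) ts) s" N] has_ty_sb by (simp add: R_N)
next
  case (St \<tau> t)
  then have t: "ht (sb ((!) ts) t) \<tau>" using has_ty_sb by simp
  have "nf (sb ((!) ts) t) \<in> SS \<tau> \<longleftrightarrow> St \<tau> (sb ((!) ts) t) \<in> S"
  proof
    assume "nf (sb ((!) ts) t) \<in> SS \<tau>"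
    then obtain s where "nf s = nf (sb ((!) ts) t)" "ht s \<tau>" "St \<tau> s \<in> S" by (auto simp: SS_def)
    then show "St \<tau> (sb ((!) ts) t) \<in> S" using nf_eq_iff t St_mem_cong by blast
  qed (use t in \<open>auto simp: SS_def\<close>)
  then show ?case using St ev_nf by simp
next
  case (Imp A B)
  then show ?case using wff_sbf[OF Imp.prems(1)] by simp
next
  case (Forall \<sigma> A)
  have "M.sat (map nf ts) (Forall \<sigma> A) \<longleftrightarrow> (\<forall>t. ht t \<sigma> \<longrightarrow> M.sat (map nf (t # ts)) A)"
    by (auto simp: DD_def)
  also have "\<dots> \<longleftrightarrow> (\<forall>t. ht t \<sigma> \<longrightarrow> sbf ((!) (t # ts)) A \<in> S)"
    using Forall.IH[of "_ # ts" "\<sigma> # E"] Forall.prems by (metis list_all2_Cons wf_fm.simps(5))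
  also have "\<dots> \<longleftrightarrow> sbf ((!) ts) (Forall \<sigma> A) \<in> S"
    using Forall_mem[of \<sigma> "sbf (up ((!) ts)) A"] wff_sbf[OF Forall.prems]
    by (simp add: inst_up nth_case_nat)
  finally show ?case .
qed simp

lemma env_rep:
  "M.env xs E \<Longrightarrow> \<exists>ts. xs = map nf ts \<and> list_all2 ht ts E"
proof (induction rule: list_all2_induct)
  case (Cons x xs \<sigma> E)
  then obtain t ts where "x = nf t" "ht t \<sigma>" "xs = map nf ts" "list_all2 ht ts E"
    by (auto simp: DD_def)
  then have "x # xs = map nf (t # ts) \<and> list_all2 ht (t # ts) (\<sigma> # E)" by auto
  then show ?case by (rule exI)
qed simp

lemma term_model: "model \<Sigma> DD (\<lambda>s t. nf (s \<cdot> t)) nf SS"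
proof
  fix E t \<tau> xs assume "tyof \<Sigma> E t = Some \<tau>" "M.env xs E"
  then show "M.ev xs t \<in> DD \<tau>" using env_rep[of xs E] by (auto simp: ev_nf DD_def has_ty_sb)
next
  fix E A xs assume ax: "RCA0_Omega \<Sigma> E A" and wf: "wf_fm \<Sigma> E A" and xs: "M.env xs E"
  obtain ts where ts: "xs = map nf ts" "list_all2 ht ts E" using env_rep[OF xs] by blast
  obtain n where n: "typed \<Sigma> ((!) ts) E (ctx n)" using env_typed[OF ts(2)] by blast
  have "derives \<Sigma> E [] A" using ax wf by (rule Axm)
  from derives_sbf[OF this _ wf n] have "derives \<Sigma> (ctx n) [] (sbf ((!) ts) A)" by simp
  then have "sbf ((!) ts) A \<in> S" by (rule derivable_mem[rotated]) (use wff_sbf[OF ts(2) wf] in auto)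
  then show "M.sat xs A" using truth[OF ts(2) wf] ts(1) by simp
next
  fix E s t \<tau> xs assume s: "tyof \<Sigma> E s = Some \<tau>" and t: "tyof \<Sigma> E t = Some \<tau>" and xs: "M.env xs E"
  obtain ts where ts: "xs = map nf ts" "list_all2 ht ts E" using env_rep[OF xs] by blast
  show "M.sat xs (eq \<tau> s t) \<longleftrightarrow> M.ev xs s = M.ev xs t"
    using truth[OF ts(2) wf_eq[OF s t]] ev_nf[OF ts(2)] s t nf_eq_iff[OF has_ty_sb has_ty_sb, OF ts(2) s ts(2) t] ts(1)
    by (simp add: R_def)
qed (auto simp: DD_def SS_def)

lemma sentence_truth: "wf_fm \<Sigma> [] A \<Longrightarrow> interp.sat DD (\<lambda>s t. nf (s \<cdot> t)) nf SS [] A \<longleftrightarrow> A \<in> S"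
  using truth[of "[]" "[]" A] sbf_cong_wf[of \<Sigma> "[]" A "(!) []" V] by simp

end

text \<open>Models on the carrier \<open>tm\<close> suffice, since an unprovable sentence already
  fails in a model made of terms.\<close>

theorem completeness:
  assumes A: "wf_fm \<Sigma> [] A"
    and valid: "\<And>D ap cst (st :: ty \<Rightarrow> tm set). model \<Sigma> D ap cst st \<Longrightarrow> interp.sat D ap cst st [] A"
  shows "derives \<Sigma> [] [] A"
proof (rule ccontr)
  assume neg: "\<not> derives \<Sigma> [] [] A"
  have wf: "wf_fm \<Sigma> (ctx n) A" for n using wf_append[OF A, of "ctx n"] by simp
  have "consistent \<Sigma> [Neg A]"
    unfolding consistent_def
  proof (intro conjI allI notI)
    show "\<forall>B \<in> set [Neg A]. wff \<Sigma> B" using wf by (auto simp: wff_def)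
    fix n assume "derives \<Sigma> (ctx n) [Neg A] Fls"
    then have d: "derives \<Sigma> (ctx n) [] A" by (rule Classical[OF wf])
    \<comment> \<open>The sentence has no free variables of its own, so those of
      \<open>ctx n\<close> can be replaced by closed default terms, which brings the derivation back
      to the empty context.\<close>
    have "derives \<Sigma> [] [] (sbf (\<lambda>k. zero_of (var_ty k)) A)"
      using derives_sbf[OF d _ wf, of "\<lambda>k. zero_of (var_ty k)" "[]"] by (simp add: typed_def)
    moreover have "sbf (\<lambda>k. zero_of (var_ty k)) A = A"
      using sbf_cong_wf[OF A, of "\<lambda>k. zero_of (var_ty k)" V] by simp
    ultimately show False using neg by simp
  qed
  then obtain S where S: "henkin_set \<Sigma> S" "Neg A \<in> S" by (rule henkin_set_exists) auto
  interpret henkin_set \<Sigma> S by fact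
  have "A \<in> S" using valid[OF term_model] sentence_truth[OF A] by blast
  with mp_mem[OF S(2)] show False by simp
qed

section \<open>Reasoning in a model\<close>

context model
begin

lemma ev_lift [simp]: "ev (x # xs) (lift t) = ev xs t"
  by (induction t) auto

lemma sat_sbf:
  "wf_fm \<Sigma> E A \<Longrightarrow> length ys = length E \<Longrightarrow> (\<And>i. i < length E \<Longrightarrow> ev xs (\<theta> i) = ys ! i) \<Longrightarrow>
    sat xs (sbf \<theta> A) \<longleftrightarrow> sat ys A"
proof (induction A arbitrary: E xs ys \<theta>)
  case (Eq s t)
  have "ev xs (sb \<theta> u) = ev ys u" if "tyof \<Sigma> E u = Some \<tau>" for u \<tau>
    using that Eq.prems by (induction u arbitrary: \<tau>) (auto split: if_splits option.splits ty.splits)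
  then show ?case using Eq.prems by auto
next
  case (St \<tau> t)
  have "ev xs (sb \<theta> u) = ev ys u" if "tyof \<Sigma> E u = Some \<tau>" for u \<tau>
    using that St.prems by (induction u arbitrary: \<tau>) (auto split: if_splits option.splits ty.splits)
  then show ?case using St.prems by auto
next
  case (Imp A B)
  then show ?case by (metis sat.simps(4) sbf.simps(4) wf_fm.simps(4))
next
  case (Forall \<sigma> A)
  have "sat (x # xs) (sbf (up \<theta>) A) \<longleftrightarrow> sat (x # ys) A" for x
    by (rule Forall.IH[of "\<sigma> # E"]) (use Forall.prems in \<open>auto simp: less_Suc_eq_0_disj\<close>)
  then show ?case by simp
qed simp

lemma st_in: "x \<in> st \<tau> \<Longrightarrow> x \<in> D \<tau>"
  using st_subset by blast

lemma ap_in: "f \<in> D (\<sigma> \<rightarrow> \<tau>) \<Longrightarrow> x \<in> D \<sigma> \<Longrightarrow> f \<bullet> x \<in> D \<tau>"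
  using ev_in[of "[\<sigma> \<rightarrow> \<tau>, \<sigma>]" "V 0 \<cdot> V 1" \<tau> "[f, x]"] by simp

lemma ap_st: "f \<in> st (\<sigma> \<rightarrow> \<tau>) \<Longrightarrow> x \<in> st \<sigma> \<Longrightarrow> f \<bullet> x \<in> st \<tau>"
  using sat_axiom[OF st_app[of \<Sigma> "[\<sigma> \<rightarrow> \<tau>, \<sigma>]" \<sigma> \<tau> "V 0" "V 1"], of "[f, x]"] by (simp add: st_in)

lemma closed_st: "tyof \<Sigma> [] t = Some \<tau> \<Longrightarrow> ev [] t \<in> st \<tau>"
  using sat_axiom[OF st_closed[of \<Sigma> t \<tau> "[]"], of "[]"] by simp

text \<open>Disposes of all constants at once in the inductions on terms below.\<close>

lemma const_tm:
  assumes "tyof \<Sigma> E t = Some \<tau>" "\<forall>n. t \<noteq> V n" "\<forall>s u. t \<noteq> s \<cdot> u"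
  shows "tyof \<Sigma> E' t = Some \<tau>" "ev xs t = ev ys t" "ev xs t \<in> st \<tau>"
proof -
  show "tyof \<Sigma> E' t = Some \<tau>" "ev xs t = ev ys t" for E' ys
    using assms by (cases t; simp)+
  then show "ev xs t \<in> st \<tau>" using closed_st by metis
qed

lemma ev_st:
  "tyof \<Sigma> E t = Some \<tau> \<Longrightarrow> list_all2 (\<lambda>x \<sigma>. x \<in> st \<sigma>) xs E \<Longrightarrow> ev xs t \<in> st \<tau>"
proof (induction t arbitrary: \<tau>)
  case (V n)
  then show ?case by (auto simp: list_all2_conv_all_nth split: if_splits)
next
  case (App s t)
  then obtain \<sigma> where "tyof \<Sigma> E s = Some (\<sigma> \<rightarrow> \<tau>)" "tyof \<Sigma> E t = Some \<sigma>"
    by (auto split: option.splits ty.splits if_splits)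
  then show ?case using App ap_st by simp
qed (erule const_tm(3); simp)+

section \<open>Combinatory completeness\<close>

lemma K_ap: "x \<in> D \<sigma> \<Longrightarrow> y \<in> D \<tau> \<Longrightarrow> cst (Comb_K \<sigma> \<tau>) \<bullet> x \<bullet> y = x"
  using sat_axiom[OF base[OF comb_K[of "[\<sigma>, \<tau>]" \<sigma> \<tau> "V 0" "V 1"]], of "[x, y]"]
    sat_eq[of "[\<sigma>, \<tau>]" "Comb_K \<sigma> \<tau> \<cdot> V 0 \<cdot> V 1" \<sigma> "V 0" "[x, y]"]
  by (simp add: wf_eq)

lemma S_ap:
  assumes "r \<in> D (\<rho> \<rightarrow> \<sigma> \<rightarrow> \<tau>)" "s \<in> D (\<rho> \<rightarrow> \<sigma>)" "t \<in> D \<rho>"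
  shows "cst (Comb_S \<rho> \<sigma> \<tau>) \<bullet> r \<bullet> s \<bullet> t = r \<bullet> t \<bullet> (s \<bullet> t)"
  using sat_axiom[OF base[OF comb_S[of "[\<rho> \<rightarrow> \<sigma> \<rightarrow> \<tau>, \<rho> \<rightarrow> \<sigma>, \<rho>]" \<tau> \<rho> \<sigma> "V 0" "V 1" "V 2"]], of "[r, s, t]"]
    sat_eq[of "[\<rho> \<rightarrow> \<sigma> \<rightarrow> \<tau>, \<rho> \<rightarrow> \<sigma>, \<rho>]" "Comb_S \<rho> \<sigma> \<tau> \<cdot> V 0 \<cdot> V 1 \<cdot> V 2" \<tau> "V 0 \<cdot> V 2 \<cdot> (V 1 \<cdot> V 2)" "[r, s, t]"]
    assms
  by (simp add: wf_eq)

lemma fun_ext: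
  assumes "f \<in> D (\<sigma> \<rightarrow> N)" "g \<in> D (\<sigma> \<rightarrow> N)" "\<And>x. x \<in> D \<sigma> \<Longrightarrow> f \<bullet> x = g \<bullet> x" shows "f = g"
  using sat_eq[of "[\<sigma> \<rightarrow> N, \<sigma> \<rightarrow> N]" "V 0" "\<sigma> \<rightarrow> N" "V 1" "[f, g]"] assms by simp

lemma lambda_const:
  assumes t: "tyof \<Sigma> (\<sigma> # E) t = Some \<tau>" "\<forall>n. t \<noteq> V n" "\<forall>s u. t \<noteq> s \<cdot> u"
  shows "\<exists>t'. tyof \<Sigma> E t' = Some (\<sigma> \<rightarrow> \<tau>) \<and> (\<forall>xs x. env xs E \<longrightarrow> x \<in> D \<sigma> \<longrightarrow> ev xs t' \<bullet> x = ev (x # xs) t)"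
proof (intro exI conjI allI impI)
  show "tyof \<Sigma> E (Comb_K \<tau> \<sigma> \<cdot> t) = Some (\<sigma> \<rightarrow> \<tau>)" using const_tm(1)[OF t] by simp
  show "ev xs (Comb_K \<tau> \<sigma> \<cdot> t) \<bullet> x = ev (x # xs) t" if "x \<in> D \<sigma>" for xs x
    using K_ap[OF st_in[OF const_tm(3)[OF t]] that] const_tm(2)[OF t, of xs "x # xs"] by simp
qed

text \<open>Bracket abstraction: \<open>S K K\<close> for the bound variable, \<open>K\<close> for
  constants and other variables, \<open>S\<close> for an application.\<close>

lemma lambda_tm:
  assumes "tyof \<Sigma> (\<sigma> # E) t = Some \<tau>"
  shows "\<exists>t'. tyof \<Sigma> E t' = Some (\<sigma> \<rightarrow> \<tau>) \<and> (\<forall>xs x. env xs E \<longrightarrow> x \<in> D \<sigma> \<longrightarrow> ev xs t' \<bullet> x = ev (x # xs) t)"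
  using assms
proof (induction t arbitrary: \<tau>)
  case (V n)
  show ?case
  proof (cases n)
    case 0
    let ?I = "Comb_S \<sigma> (\<sigma> \<rightarrow> \<sigma>) \<sigma> \<cdot> Comb_K \<sigma> (\<sigma> \<rightarrow> \<sigma>) \<cdot> Comb_K \<sigma> \<sigma>"
    have K: "cst (Comb_K \<alpha> \<beta>) \<in> D (\<alpha> \<rightarrow> \<beta> \<rightarrow> \<alpha>)" for \<alpha> \<beta>
      using ev_in[of "[]" "Comb_K \<alpha> \<beta>"] by simp
    have "ev xs ?I \<bullet> x = x" if "x \<in> D \<sigma>" for x xs
      using that K by (simp add: S_ap K_ap[of _ _ _ "\<sigma> \<rightarrow> \<sigma>"] ap_in[OF K])
    then show ?thesis using V 0 by (intro exI[of _ ?I]) auto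
  next
    case (Suc m)
    then show ?thesis using V
      by (intro exI[of _ "Comb_K \<tau> \<sigma> \<cdot> V m"])
        (auto intro!: K_ap simp: list_all2_conv_all_nth split: if_splits)
  qed
next
  case (App s t)
  then obtain \<rho> where ty: "tyof \<Sigma> (\<sigma> # E) s = Some (\<rho> \<rightarrow> \<tau>)" "tyof \<Sigma> (\<sigma> # E) t = Some \<rho>"
    by (auto split: option.splits ty.splits if_splits)
  from App.IH(1)[OF ty(1)] App.IH(2)[OF ty(2)] obtain s' t' where
    s': "tyof \<Sigma> E s' = Some (\<sigma> \<rightarrow> \<rho> \<rightarrow> \<tau>)" "\<And>xs x. env xs E \<Longrightarrow> x \<in> D \<sigma> \<Longrightarrow> ev xs s' \<bullet> x = ev (x # xs) s" and
    t': "tyof \<Sigma> E t' = Some (\<sigma> \<rightarrow> \<rho>)" "\<And>xs x. env xs E \<Longrightarrow> x \<in> D \<sigma> \<Longrightarrow> ev xs t' \<bullet> x = ev (x # xs) t"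
    by blast
  show ?case
    by (rule exI[of _ "Comb_S \<sigma> \<rho> \<tau> \<cdot> s' \<cdot> t'"]) (use s' t' in \<open>auto simp: S_ap[OF ev_in ev_in]\<close>)
qed (erule lambda_const; simp)+

abbreviation st_env :: "'a list \<Rightarrow> ty list \<Rightarrow> bool" where
  "st_env \<equiv> list_all2 (\<lambda>x \<sigma>. x \<in> st \<sigma>)"

text \<open>The abstraction is given by a term in the parameters, hence it is standard as soon as
  they are. The explicitly defined functionals below get their standardness in this way.\<close>

lemma abstract1:
  assumes t: "tyof \<Sigma> (\<sigma> # E) t = Some \<tau>" and xs: "env xs E"
  shows "\<exists>f \<in> D (\<sigma> \<rightarrow> \<tau>). (\<forall>x \<in> D \<sigma>. f \<bullet> x = ev (x # xs) t) \<and> (st_env xs E \<longrightarrow> f \<in> st (\<sigma> \<rightarrow> \<tau>))"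
  using lambda_tm[OF t] xs ev_in ev_st by metis

lemma abstract2:
  assumes t: "tyof \<Sigma> (\<rho> # \<sigma> # E) t = Some \<tau>" and xs: "env xs E"
  shows "\<exists>f \<in> D (\<sigma> \<rightarrow> \<rho> \<rightarrow> \<tau>). (\<forall>x \<in> D \<sigma>. \<forall>y \<in> D \<rho>. f \<bullet> x \<bullet> y = ev (y # x # xs) t) \<and>
    (st_env xs E \<longrightarrow> f \<in> st (\<sigma> \<rightarrow> \<rho> \<rightarrow> \<tau>))"
proof -
  obtain t' where t': "tyof \<Sigma> (\<sigma> # E) t' = Some (\<rho> \<rightarrow> \<tau>)"
    "\<And>xs x. env xs (\<sigma> # E) \<Longrightarrow> x \<in> D \<rho> \<Longrightarrow> ev xs t' \<bullet> x = ev (x # xs) t"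
    using lambda_tm[OF t] by blast
  obtain f where f: "f \<in> D (\<sigma> \<rightarrow> \<rho> \<rightarrow> \<tau>)" "\<forall>x \<in> D \<sigma>. f \<bullet> x = ev (x # xs) t'"
    "st_env xs E \<longrightarrow> f \<in> st (\<sigma> \<rightarrow> \<rho> \<rightarrow> \<tau>)"
    using abstract1[OF t'(1) xs] by blast
  show ?thesis by (rule bexI[of _ f]) (use f t'(2) xs in auto)
qed

lemma abstract3:
  assumes t: "tyof \<Sigma> (\<pi> # \<rho> # \<sigma> # E) t = Some \<tau>" and xs: "env xs E"
  shows "\<exists>f \<in> D (\<sigma> \<rightarrow> \<rho> \<rightarrow> \<pi> \<rightarrow> \<tau>).
    (\<forall>x \<in> D \<sigma>. \<forall>y \<in> D \<rho>. \<forall>w \<in> D \<pi>. f \<bullet> x \<bullet> y \<bullet> w = ev (w # y # x # xs) t) \<and>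
    (st_env xs E \<longrightarrow> f \<in> st (\<sigma> \<rightarrow> \<rho> \<rightarrow> \<pi> \<rightarrow> \<tau>))"
proof -
  obtain t' where t': "tyof \<Sigma> (\<rho> # \<sigma> # E) t' = Some (\<pi> \<rightarrow> \<tau>)"
    "\<And>xs x. env xs (\<rho> # \<sigma> # E) \<Longrightarrow> x \<in> D \<pi> \<Longrightarrow> ev xs t' \<bullet> x = ev (x # xs) t"
    using lambda_tm[OF t] by blast
  obtain f where f: "f \<in> D (\<sigma> \<rightarrow> \<rho> \<rightarrow> \<pi> \<rightarrow> \<tau>)"
    "\<forall>x \<in> D \<sigma>. \<forall>y \<in> D \<rho>. f \<bullet> x \<bullet> y = ev (y # x # xs) t'"
    "st_env xs E \<longrightarrow> f \<in> st (\<sigma> \<rightarrow> \<rho> \<rightarrow> \<pi> \<rightarrow> \<tau>)"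
    using abstract2[OF t'(1) xs] by blast
  show ?thesis by (rule bexI[of _ f]) (use f t'(2) xs in auto)
qed

subsection \<open>Axiom schemes\<close>

lemma qf_induct:
  assumes A: "quantifier_free A" "wf_fm \<Sigma> (N # E) A" and xs: "env xs E"
    and 0: "sat (cst Zero # xs) A"
    and Suc: "\<And>n. n \<in> D N \<Longrightarrow> sat (n # xs) A \<Longrightarrow> sat ((cst Sc \<bullet> n) # xs) A"
    and n: "n \<in> D N"
  shows "sat (n # xs) A"
proof -
  let ?\<theta> = "case_nat (Sc \<cdot> V 0) (\<lambda>k. V (Suc k))"
  have len: "length xs = length E" using xs by (rule list_all2_lengthD)
  have wf: "wf_fm \<Sigma> E (inst Zero A)" "wf_fm \<Sigma> (N # E) (sbf ?\<theta> A)"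
    by (rule wf_inst[OF A(2)], simp, rule wf_sbf[OF _ A(2)])
      (auto simp: typed_def less_Suc_eq_0_disj)
  have 1: "sat xs (inst Zero A) \<longleftrightarrow> sat (cst Zero # xs) A"
    unfolding inst_def by (rule sat_sbf[OF A(2)]) (auto simp: len less_Suc_eq_0_disj)
  have 2: "sat (m # xs) (sbf ?\<theta> A) \<longleftrightarrow> sat ((cst Sc \<bullet> m) # xs) A" for m
    by (rule sat_sbf[OF A(2)]) (auto simp: len less_Suc_eq_0_disj)
  show ?thesis
    using sat_axiom[OF base[OF QF_induction[OF A(1)]], of E xs] wf A(2) xs 1 2 0 Suc n by simp
qed

lemma qf_choice:
  assumes A: "quantifier_free A" "wf_fm \<Sigma> (N # ty1 # E) A" and xs: "env xs E"
    and ex: "\<And>x. x \<in> D ty1 \<Longrightarrow> \<exists>n \<in> D N. sat (n # x # xs) A"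
  obtains F where "F \<in> D ty2" "\<And>x. x \<in> D ty1 \<Longrightarrow> sat ((F \<bullet> x) # x # xs) A"
proof -
  let ?\<theta> = "case_nat (V 1 \<cdot> V 0) (case_nat (V 0) (\<lambda>k. V (k + 2)))"
  have len: "length xs = length E" using xs by (rule list_all2_lengthD)
  have wf: "wf_fm \<Sigma> (ty1 # ty2 # E) (sbf ?\<theta> A)"
    by (rule wf_sbf[OF _ A(2)]) (auto simp: typed_def less_Suc_eq_0_disj)
  have "sat (x # F # xs) (sbf ?\<theta> A) \<longleftrightarrow> sat ((F \<bullet> x) # x # xs) A" for x F
    by (rule sat_sbf[OF A(2)]) (auto simp: len less_Suc_eq_0_disj)
  then show ?thesis
    using sat_axiom[OF base[OF QF_AC_1_0[OF A(1)]], of E xs] wf A(2) xs ex that by auto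
qed

lemma hac:
  assumes A: "internal A" "wf_fm \<Sigma> [\<tau>, \<rho>] A"
    and ex: "\<And>x. x \<in> st \<rho> \<Longrightarrow> \<exists>y \<in> st \<tau>. sat [y, x] A"
  obtains F where "F \<in> st (\<rho> \<rightarrow> Star \<tau>)"
    "\<And>x. x \<in> st \<rho> \<Longrightarrow> \<exists>y \<in> D \<tau>. sat [y, x, F] (mem \<tau> (V 0) (V 2 \<cdot> V 1)) \<and> sat [y, x] A"
proof -
  have wf: "wf_fm \<Sigma> [\<tau>, \<rho>, \<rho> \<rightarrow> Star \<tau>] (shift2 A)"
    unfolding shift2_def by (rule wf_sbf[OF _ A(2)]) (auto simp: typed_def less_Suc_eq_0_disj)
  have wm: "wf_fm \<Sigma> [\<tau>, \<rho>, \<rho> \<rightarrow> Star \<tau>] (mem \<tau> (V 0) (V 2 \<cdot> V 1))"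
    by (simp add: mem_def ForallLess_def lt_fm_def le_fm_def monus_tm_def iter_step_def pred_tm_def wf_eq)
  have "sat [y, x, F] (shift2 A) \<longleftrightarrow> sat [y, x] A" for y x F
    unfolding shift2_def by (rule sat_sbf[OF A(2)]) (auto simp: less_Suc_eq_0_disj)
  moreover have "\<forall>x \<in> D \<rho>. x \<in> st \<rho> \<longrightarrow> (\<exists>y \<in> D \<tau>. y \<in> st \<tau> \<and> sat [y, x] A)"
    using ex st_in by blast
  ultimately show ?thesis
    using sat_axiom[OF HAC_int[OF A(1), of \<Sigma> "[]" \<rho> \<tau>], of "[]"] wf wm A(2) that st_in by auto
qed

text \<open>This is \<open>PF_TP\<close> for the negated formula. Typing \<open>A\<close> in
  \<open>[\<tau>]\<close> alone expresses the absence of parameters.\<close>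

lemma transfer_ex:
  assumes A: "internal A" "wf_fm \<Sigma> [\<tau>] A" and x: "x \<in> D \<tau>" "sat [x] A"
  obtains y where "y \<in> st \<tau>" "sat [y] A"
proof -
  have "RCA0_Omega \<Sigma> [] (Imp (ForallSt \<tau> (Neg A)) (Forall \<tau> (Neg A)))"
    by (rule PF_TP) (use A in auto)
  from sat_axiom[OF this, of "[]"] show ?thesis using A x that by auto
qed

lemma transfer_all:
  assumes A: "internal A" "wf_fm \<Sigma> [\<tau>] A" and "\<And>x. x \<in> st \<tau> \<Longrightarrow> sat [x] A" and x: "x \<in> D \<tau>"
  shows "sat [x] A"
  using sat_axiom[OF PF_TP[OF A], of "[]" "[]"] assms by auto

end

text \<open>Case distinction on whether \<open>a\<close> is zero, as a recursion whose step ignores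
  both of its arguments.\<close>

definition ifz_tm :: "tm \<Rightarrow> tm \<Rightarrow> tm \<Rightarrow> tm" where
  "ifz_tm a b c = Rec0 \<cdot> a \<cdot> b \<cdot> (Comb_K (N \<rightarrow> N) N \<cdot> (Comb_K N N \<cdot> c))"

lemma tyof_arith [simp]:
  "tyof \<Sigma> E s = Some N \<Longrightarrow> tyof \<Sigma> E t = Some N \<Longrightarrow> tyof \<Sigma> E (plus_tm s t) = Some N"
  "tyof \<Sigma> E s = Some N \<Longrightarrow> tyof \<Sigma> E t = Some N \<Longrightarrow> tyof \<Sigma> E (times_tm s t) = Some N"
  "tyof \<Sigma> E s = Some N \<Longrightarrow> tyof \<Sigma> E t = Some N \<Longrightarrow> tyof \<Sigma> E (monus_tm s t) = Some N"
  "tyof \<Sigma> E s = Some N \<Longrightarrow> tyof \<Sigma> E t = Some N \<Longrightarrow> tyof \<Sigma> E (pair_tm s t) = Some N"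
  "tyof \<Sigma> E r = Some N \<Longrightarrow> tyof \<Sigma> E s = Some N \<Longrightarrow> tyof \<Sigma> E t = Some N \<Longrightarrow> tyof \<Sigma> E (ifz_tm r s t) = Some N"
  "tyof \<Sigma> E pred_tm = Some (N \<rightarrow> N)"
  "tyof \<Sigma> E One = Some N"
  by (simp_all add: plus_tm_def times_tm_def monus_tm_def pair_tm_def ifz_tm_def iter_step_def pred_tm_def One_def)

context model
begin

subsection \<open>Arithmetic\<close>

abbreviation z :: 'a where "z \<equiv> cst Zero"
abbreviation sc :: "'a \<Rightarrow> 'a" where "sc n \<equiv> cst Sc \<bullet> n"

definition add where "add m n = ev [m, n] (plus_tm (V 0) (V 1))"
definition mon where "mon m n = ev [m, n] (monus_tm (V 0) (V 1))"
definition prd where "prd n = ev [n] (pred_tm \<cdot> V 0)"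
definition pr where "pr m n = ev [m, n] (pair_tm (V 0) (V 1))"
definition ifz where "ifz a b c = ev [a, b, c] (ifz_tm (V 0) (V 1) (V 2))"

lemma ev_arith [simp]:
  "ev xs (plus_tm s t) = add (ev xs s) (ev xs t)"
  "ev xs (monus_tm s t) = mon (ev xs s) (ev xs t)"
  "ev xs pred_tm \<bullet> x = prd x"
  "ev xs (pair_tm s t) = pr (ev xs s) (ev xs t)"
  "ev xs (ifz_tm r s t) = ifz (ev xs r) (ev xs s) (ev xs t)"
  "ev xs One = sc z"
  by (simp_all add: add_def mon_def prd_def pr_def ifz_def plus_tm_def times_tm_def monus_tm_def
      pair_tm_def ifz_tm_def iter_step_def pred_tm_def One_def)

lemma arith_in [simp]:
  "z \<in> D N" "n \<in> D N \<Longrightarrow> sc n \<in> D N" "m \<in> D N \<Longrightarrow> n \<in> D N \<Longrightarrow> add m n \<in> D N"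
  "m \<in> D N \<Longrightarrow> n \<in> D N \<Longrightarrow> mon m n \<in> D N" "n \<in> D N \<Longrightarrow> prd n \<in> D N"
  "m \<in> D N \<Longrightarrow> n \<in> D N \<Longrightarrow> pr m n \<in> D N"
  "a \<in> D N \<Longrightarrow> m \<in> D N \<Longrightarrow> n \<in> D N \<Longrightarrow> ifz a m n \<in> D N"
  using ev_in[of "[]" Zero N "[]"] ev_in[of "[N]" "Sc \<cdot> V 0" N "[n]"]
    ev_in[of "[N, N]" "plus_tm (V 0) (V 1)" N "[m, n]"] ev_in[of "[N, N]" "monus_tm (V 0) (V 1)" N "[m, n]"]
    ev_in[of "[N]" "pred_tm \<cdot> V 0" N "[n]"] ev_in[of "[N, N]" "pair_tm (V 0) (V 1)" N "[m, n]"]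
    ev_in[of "[N, N, N]" "ifz_tm (V 0) (V 1) (V 2)" N "[a, m, n]"]
  by simp_all

lemma arith_st:
  "z \<in> st N" "m \<in> st N \<Longrightarrow> n \<in> st N \<Longrightarrow> pr m n \<in> st N"
  using ev_st[of "[]" Zero N "[]"] ev_st[of "[N, N]" "pair_tm (V 0) (V 1)" N "[m, n]"]
  by simp_all

lemma sc_neq_z [simp]: "n \<in> D N \<Longrightarrow> sc n \<noteq> z" "n \<in> D N \<Longrightarrow> z \<noteq> sc n"
  using sat_axiom[OF base[OF suc_neq_zero[of "[N]" "V 0"]], of "[n]"] by auto

lemma rec_z: "s \<in> D N \<Longrightarrow> t \<in> D (N \<rightarrow> N \<rightarrow> N) \<Longrightarrow> cst Rec0 \<bullet> z \<bullet> s \<bullet> t = s"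
  using sat_axiom[OF base[OF rec_zero[of "[N, N \<rightarrow> N \<rightarrow> N]" "V 0" "V 1"]], of "[s, t]"] by simp

lemma rec_sc:
  "n \<in> D N \<Longrightarrow> s \<in> D N \<Longrightarrow> t \<in> D (N \<rightarrow> N \<rightarrow> N) \<Longrightarrow>
    cst Rec0 \<bullet> sc n \<bullet> s \<bullet> t = t \<bullet> (cst Rec0 \<bullet> n \<bullet> s \<bullet> t) \<bullet> n"
  using sat_axiom[OF base[OF rec_suc[of "[N, N, N \<rightarrow> N \<rightarrow> N]" "V 0" "V 1" "V 2"]], of "[n, s, t]"] by simp

lemma rec_in: "n \<in> D N \<Longrightarrow> s \<in> D N \<Longrightarrow> t \<in> D (N \<rightarrow> N \<rightarrow> N) \<Longrightarrow> cst Rec0 \<bullet> n \<bullet> s \<bullet> t \<in> D N"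
  using ev_in[of "[N, N, N \<rightarrow> N \<rightarrow> N]" "Rec0 \<cdot> V 0 \<cdot> V 1 \<cdot> V 2" N "[n, s, t]"] by simp

lemma K_in: "cst (Comb_K \<sigma> \<tau>) \<in> D (\<sigma> \<rightarrow> \<tau> \<rightarrow> \<sigma>)"
  using ev_in[of "[]" "Comb_K \<sigma> \<tau>"] by simp

lemma iter_step_in: "tyof \<Sigma> [] t = Some ty1 \<Longrightarrow> ev [] (iter_step t) \<in> D (N \<rightarrow> N \<rightarrow> N)"
  by (rule ev_in[of "[]"]) (simp_all add: iter_step_def)

lemma iter_step_ap:
  assumes "ev xs t \<in> D ty1" "r \<in> D N" "k \<in> D N"
  shows "ev xs (iter_step t) \<bullet> r \<bullet> k = ev xs t \<bullet> r"
  by (simp add: iter_step_def S_ap[OF ap_in[OF K_in K_in] assms(1,2)] K_ap[OF K_in assms(2)]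
      K_ap[OF ap_in[OF assms(1,2)] assms(3)])

lemma Sc_in: "cst Sc \<in> D ty1" and pred_in: "ev xs pred_tm \<in> D ty1"
  using ev_in[of "[]" Sc ty1 "[]"] ev_in[of "[]" pred_tm ty1 "[]"] by (simp_all add: pred_tm_def)

lemma add_simps [simp]:
  "m \<in> D N \<Longrightarrow> add m z = m" "m \<in> D N \<Longrightarrow> n \<in> D N \<Longrightarrow> add m (sc n) = sc (add m n)"
proof -
  have st: "ev [] (iter_step Sc) \<in> D (N \<rightarrow> N \<rightarrow> N)"
    by (rule iter_step_in) simp
  have e: "ev xs (iter_step Sc) = ev [] (iter_step Sc)" for xs by (simp add: iter_step_def)
  have a: "add m n = cst Rec0 \<bullet> n \<bullet> m \<bullet> ev [] (iter_step Sc)" for m n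
    using e[of "[m, n]"] by (simp add: add_def plus_tm_def)
  show "m \<in> D N \<Longrightarrow> add m z = m" using st by (simp add: a rec_z)
  show "m \<in> D N \<Longrightarrow> n \<in> D N \<Longrightarrow> add m (sc n) = sc (add m n)"
    using st iter_step_ap[of "[]" Sc] Sc_in by (simp add: a rec_sc rec_in)
qed

lemma mon_simps [simp]:
  "m \<in> D N \<Longrightarrow> mon m z = m" "m \<in> D N \<Longrightarrow> n \<in> D N \<Longrightarrow> mon m (sc n) = prd (mon m n)"
proof -
  have st: "ev [] (iter_step pred_tm) \<in> D (N \<rightarrow> N \<rightarrow> N)"
    by (rule iter_step_in) simp
  have e: "ev xs (iter_step pred_tm) = ev [] (iter_step pred_tm)" for xs
    by (simp add: iter_step_def pred_tm_def)
  have a: "mon m n = cst Rec0 \<bullet> n \<bullet> m \<bullet> ev [] (iter_step pred_tm)" for m n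
    using e[of "[m, n]"] by (simp add: mon_def monus_tm_def)
  show "m \<in> D N \<Longrightarrow> mon m z = m" using st by (simp add: a rec_z)
  show "m \<in> D N \<Longrightarrow> n \<in> D N \<Longrightarrow> mon m (sc n) = prd (mon m n)"
    using st iter_step_ap[of "[]" pred_tm] pred_in by (simp add: a rec_sc rec_in)
qed

lemma prd_simps [simp]: "prd z = z" "n \<in> D N \<Longrightarrow> prd (sc n) = n"
proof -
  let ?P = "Comb_K (N \<rightarrow> N) N \<cdot> (Comb_S N (N \<rightarrow> N) N \<cdot> Comb_K N (N \<rightarrow> N) \<cdot> Comb_K N N)"
  have P: "ev xs ?P \<in> D (N \<rightarrow> N \<rightarrow> N)" for xs
    using ev_in[of "[]" ?P _ "[]"] by simp
  have I: "ev xs (Comb_S N (N \<rightarrow> N) N \<cdot> Comb_K N (N \<rightarrow> N) \<cdot> Comb_K N N) \<in> D (N \<rightarrow> N)" for xs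
    using ev_in[of "[]" "Comb_S N (N \<rightarrow> N) N \<cdot> Comb_K N (N \<rightarrow> N) \<cdot> Comb_K N N" _ "[]"] by simp
  have Pap: "ev xs ?P \<bullet> r \<bullet> k = k" if "r \<in> D N" "k \<in> D N" for xs r k
    using K_ap[OF I[of xs] that(1)] S_ap[OF K_in K_in that(2)] K_ap[OF that(2) ap_in[OF K_in that(2)]]
    by simp
  have L: "ev xs (Comb_S N N ((N \<rightarrow> N \<rightarrow> N) \<rightarrow> N) \<cdot> Rec0 \<cdot> (Comb_K N N \<cdot> Zero)) \<in> D (N \<rightarrow> (N \<rightarrow> N \<rightarrow> N) \<rightarrow> N)" for xs
    using ev_in[of "[]" "Comb_S N N ((N \<rightarrow> N \<rightarrow> N) \<rightarrow> N) \<cdot> Rec0 \<cdot> (Comb_K N N \<cdot> Zero)" _ "[]"] by simp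
  have Kz: "cst (Comb_K N N) \<bullet> z \<in> D ty1" by (rule ap_in[OF K_in]) simp
  have KP: "cst (Comb_K (N \<rightarrow> N \<rightarrow> N) N) \<bullet> ev [] ?P \<in> D (N \<rightarrow> N \<rightarrow> N \<rightarrow> N)"
    by (rule ap_in[OF K_in P])
  have R: "cst Rec0 \<in> D (N \<rightarrow> N \<rightarrow> (N \<rightarrow> N \<rightarrow> N) \<rightarrow> N)" using ev_in[of "[]" Rec0 _ "[]"] by simp
  have *: "prd n = cst Rec0 \<bullet> n \<bullet> z \<bullet> ev [] ?P" if n: "n \<in> D N" for n
  proof -
    have "prd n = ev [] (Comb_S N N ((N \<rightarrow> N \<rightarrow> N) \<rightarrow> N) \<cdot> Rec0 \<cdot> (Comb_K N N \<cdot> Zero)) \<bullet> n \<bullet> (cst (Comb_K (N \<rightarrow> N \<rightarrow> N) N) \<bullet> ev [] ?P \<bullet> n)"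
      using S_ap[OF L[of "[]"] KP n] by (simp add: prd_def pred_tm_def)
    also have "\<dots> = cst Rec0 \<bullet> n \<bullet> z \<bullet> ev [] ?P"
      using S_ap[OF R Kz n] K_ap[OF P[of "[]"] n] K_ap[of z N n N] n by simp
    finally show ?thesis .
  qed
  show "prd z = z" by (simp only: * arith_in rec_z[OF _ P])
  show "prd (sc n) = n" if n: "n \<in> D N"
    using *[of "sc n"] n rec_sc[OF n _ P[of "[]"], of z] Pap[OF rec_in[OF n _ P[of "[]"], of z] n, of "[]"] by simp
qed

text \<open>Being a successor is an existential statement, to which the induction does not apply;
  naming the predecessor makes it an equation.\<close>

lemma z_or_sc: "n \<in> D N \<Longrightarrow> n = z \<or> n = sc (prd n)"
  using qf_induct[of "Or (Eq (V 0) Zero) (Eq (V 0) (Sc \<cdot> (pred_tm \<cdot> V 0)))" "[]" "[]" n] by auto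

lemma ifz_simps [simp]:
  "b \<in> D N \<Longrightarrow> c \<in> D N \<Longrightarrow> ifz z b c = b"
  "a \<in> D N \<Longrightarrow> b \<in> D N \<Longrightarrow> c \<in> D N \<Longrightarrow> a \<noteq> z \<Longrightarrow> ifz a b c = c"
proof -
  assume b: "b \<in> D N" and c: "c \<in> D N"
  let ?t = "cst (Comb_K (N \<rightarrow> N) N) \<bullet> (cst (Comb_K N N) \<bullet> c)"
  have i: "ifz a b c = cst Rec0 \<bullet> a \<bullet> b \<bullet> ?t" for a by (simp add: ifz_def ifz_tm_def)
  have Kc: "cst (Comb_K N N) \<bullet> c \<in> D ty1" by (rule ap_in[OF K_in c])
  have t: "?t \<in> D (N \<rightarrow> N \<rightarrow> N)" by (rule ap_in[OF K_in Kc])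
  show "ifz z b c = b" using b t by (simp add: i rec_z)
  show "ifz a b c = c" if "a \<in> D N" "a \<noteq> z"
  proof -
    have "ifz (sc (prd a)) b c = c"
      using that b c by (simp add: i rec_sc[OF _ _ t] K_ap[OF Kc] K_ap[OF c] rec_in[OF _ _ t])
    then show ?thesis using that z_or_sc by metis
  qed
qed

lemma ifz_if: "a \<in> D N \<Longrightarrow> b \<in> D N \<Longrightarrow> c \<in> D N \<Longrightarrow> ifz a b c = (if a = z then b else c)"
  by simp

lemma add_z_left [simp]: "n \<in> D N \<Longrightarrow> add z n = n"
  using qf_induct[of "Eq (plus_tm Zero (V 0)) (V 0)" "[]" "[]" n] by simp

lemma add_sc_left: "m \<in> D N \<Longrightarrow> n \<in> D N \<Longrightarrow> add (sc m) n = sc (add m n)"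
  using qf_induct[of "Eq (plus_tm (Sc \<cdot> V 1) (V 0)) (Sc \<cdot> (plus_tm (V 1) (V 0)))" "[N]" "[m]" n] by simp

lemma mon_z_left: "n \<in> D N \<Longrightarrow> mon z n = z"
  using qf_induct[of "Eq (monus_tm Zero (V 0)) Zero" "[]" "[]" n] by simp

lemma prd_mon_sc: "m \<in> D N \<Longrightarrow> n \<in> D N \<Longrightarrow> prd (mon (sc m) n) = mon m n"
  using qf_induct[of "Eq (pred_tm \<cdot> (monus_tm (Sc \<cdot> V 1) (V 0))) (monus_tm (V 1) (V 0))" "[N]" "[m]" n] by simp

lemma mon_add: "m \<in> D N \<Longrightarrow> n \<in> D N \<Longrightarrow> mon n (add m n) = z"
  using qf_induct[of "Eq (monus_tm (V 0) (plus_tm (V 1) (V 0))) Zero" "[N]" "[m]" n]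
  by (simp add: mon_z_left prd_mon_sc)

text \<open>The code is a sum whose last summand is \<open>m\<close>. Hence \<open>pr m n\<close>
  can itself serve as the bound in a search for \<open>m\<close>.\<close>

lemma mon_pr:
  assumes "m \<in> D N" "n \<in> D N" shows "mon m (pr m n) = z"
proof -
  have "pr m n = add (ev [m, n] (times_tm (plus_tm (V 0) (V 1)) (plus_tm (V 0) (V 1)))) m"
    by (simp add: pr_def pair_tm_def del: ev_arith(4))
  moreover have "ev [m, n] (times_tm (plus_tm (V 0) (V 1)) (plus_tm (V 0) (V 1))) \<in> D N"
    by (rule ev_in[of "[N, N]"]) (use assms in auto)
  ultimately show ?thesis using mon_add assms by simp
qed

text \<open>Expresses the comparison of \<open>m\<close> and \<open>n\<close> without quantifiers,
  so that the available induction proves it.\<close>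

lemma mon_dichotomy:
  assumes m: "m \<in> D N" and n: "n \<in> D N" shows "mon m n = z \<or> add n (mon m n) = m"
proof -
  have "sat [n, m] (Or (Eq (monus_tm (V 1) (V 0)) Zero) (Eq (plus_tm (V 0) (monus_tm (V 1) (V 0))) (V 1)))"
  proof (rule qf_induct[of _ "[N]"])
    fix k assume k: "k \<in> D N"
      and IH: "sat [k, m] (Or (Eq (monus_tm (V 1) (V 0)) Zero) (Eq (plus_tm (V 0) (monus_tm (V 1) (V 0))) (V 1)))"
    show "sat [sc k, m] (Or (Eq (monus_tm (V 1) (V 0)) Zero) (Eq (plus_tm (V 0) (monus_tm (V 1) (V 0))) (V 1)))"
    proof (cases "mon m k = z")
      case True
      then show ?thesis using m k by simp
    next
      case False
      \<comment> \<open>A nonzero difference is a successor; lowering it by one while raising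
        \<open>k\<close> by one keeps the sum.\<close>
      then have "mon m k = sc (prd (mon m k))" using z_or_sc[of "mon m k"] m k by simp
      moreover have "add k (mon m k) = m" using IH False by simp
      ultimately have "add k (sc (prd (mon m k))) = m" by simp
      then show ?thesis using m k by (simp add: add_sc_left)
    qed
  qed (use m n in auto)
  then show ?thesis by auto
qed

text \<open>A difference whose predecessor is \<open>z\<close> is \<open>z\<close> or
  \<open>sc z\<close>, and \<open>mon_dichotomy\<close> turns the latter into
  \<open>m = sc n\<close>.\<close>

lemma mon_sc_cases:
  assumes m: "m \<in> D N" and n: "n \<in> D N" and "mon m (sc n) = z" shows "mon m n = z \<or> m = sc n"
proof (rule disjCI)
  assume "m \<noteq> sc n"
  have "mon m n = z \<or> mon m n = sc z" using z_or_sc[of "mon m n"] assms by auto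
  moreover have "mon m n \<noteq> sc z" using mon_dichotomy[OF m n] \<open>m \<noteq> sc n\<close> n by auto
  ultimately show "mon m n = z" by simp
qed

subsection \<open>Bounded search\<close>

text \<open>Turns a bounded existential quantifier into one equation, which terms and
  quantifier-free formulas can contain. What counts is the value of \<open>q\<close> at the number
  returned, not the size of that number.\<close>

definition searches :: "'a \<Rightarrow> bool" where
  "searches W \<longleftrightarrow> W \<in> st (ty1 \<rightarrow> N \<rightarrow> N) \<and>
    (\<forall>q \<in> D ty1. \<forall>n \<in> D N. \<forall>k \<in> D N. q \<bullet> n = z \<longrightarrow> mon n k = z \<longrightarrow> q \<bullet> (W \<bullet> q \<bullet> k) = z)"

lemma search_exists: "\<exists>W. searches W"
proof -
  \<comment> \<open>A candidate \<open>r\<close> that is a zero of \<open>q\<close> is kept;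
    otherwise the next candidate is \<open>sc j\<close>, where \<open>j\<close> counts the
    steps.\<close>
  obtain S where S: "S \<in> D (ty1 \<rightarrow> N \<rightarrow> N \<rightarrow> N)" "S \<in> st (ty1 \<rightarrow> N \<rightarrow> N \<rightarrow> N)"
    "\<forall>q \<in> D ty1. \<forall>r \<in> D N. \<forall>j \<in> D N. S \<bullet> q \<bullet> r \<bullet> j = ifz (q \<bullet> r) r (sc j)"
    using abstract3[of N N ty1 "[]" "ifz_tm (V 2 \<cdot> V 1) (V 1) (Sc \<cdot> V 0)" N "[]"] by auto
  obtain W where W: "W \<in> D (ty1 \<rightarrow> N \<rightarrow> N)" "W \<in> st (ty1 \<rightarrow> N \<rightarrow> N)"
    "\<forall>q \<in> D ty1. \<forall>k \<in> D N. W \<bullet> q \<bullet> k = cst Rec0 \<bullet> k \<bullet> z \<bullet> (S \<bullet> q)"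
    using abstract2[of N ty1 "[ty1 \<rightarrow> N \<rightarrow> N \<rightarrow> N]" "Rec0 \<cdot> V 0 \<cdot> Zero \<cdot> (V 2 \<cdot> V 1)" N "[S]"] S(1,2) by auto
  have "q \<bullet> (W \<bullet> q \<bullet> k) = z" if q: "q \<in> D ty1" and n: "n \<in> D N" and k: "k \<in> D N"
    and qn: "q \<bullet> n = z" and le: "mon n k = z" for q n k
  proof -
    have Wz: "W \<bullet> q \<bullet> z = z" using W(3) q rec_z ap_in[OF S(1) q] by simp
    have Wi: "W \<bullet> q \<bullet> j \<in> D N" if "j \<in> D N" for j
      using ap_in[OF ap_in[OF W(1) q] that] .
    have Ws: "W \<bullet> q \<bullet> sc j = ifz (q \<bullet> (W \<bullet> q \<bullet> j)) (W \<bullet> q \<bullet> j) (sc j)" if j: "j \<in> D N" for j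
      using W(3) S(3) q j Wi[OF j] rec_sc[OF j _ ap_in[OF S(1) q], of z]
      by simp
    \<comment> \<open>Induction on the bound. At \<open>z\<close> the bound forces
      \<open>n = z\<close>, the starting value; at \<open>sc j\<close> either \<open>n\<close> was
      already within reach, or it is \<open>sc j\<close>, which is tried if the search has not yet
      succeeded.\<close>
    have "sat [k, n, q, W] (Imp (Eq (monus_tm (V 1) (V 0)) Zero) (Eq (V 2 \<cdot> (V 3 \<cdot> V 2 \<cdot> V 0)) Zero))"
    proof (rule qf_induct[of _ "[N, ty1, ty1 \<rightarrow> N \<rightarrow> N]"])
      fix j assume j: "j \<in> D N"
        and IH: "sat [j, n, q, W] (Imp (Eq (monus_tm (V 1) (V 0)) Zero) (Eq (V 2 \<cdot> (V 3 \<cdot> V 2 \<cdot> V 0)) Zero))"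
      have "q \<bullet> (W \<bullet> q \<bullet> sc j) = z" if "mon n (sc j) = z"
        using mon_sc_cases[OF n j that] IH qn Ws[OF j] Wi[OF j] j ap_in[OF q Wi[OF j]]
        by (auto simp: ifz_if)
      then show "sat [sc j, n, q, W] (Imp (Eq (monus_tm (V 1) (V 0)) Zero) (Eq (V 2 \<cdot> (V 3 \<cdot> V 2 \<cdot> V 0)) Zero))"
        by simp
    qed (use q n k W qn Wz in auto)
    then show ?thesis using le by simp
  qed
  then show ?thesis using W(2) unfolding searches_def by blast
qed

end

section \<open>The implications\<close>

text \<open>\<open>rel\<close> spares bounded number quantifiers, which it recognizes by the shape
  of the body. The existential quantifiers of the principles must not be mistaken for these: their
  equations have a variable at the head, where a bound has \<open>Rec0\<close>.\<close>

lemma not_bounded_body [simp]: "\<not> bounded_body (Imp (Eq (V k \<cdot> s) t) B)"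
  by (simp add: bounded_body_def le_fm_def lt_fm_def monus_tm_def)

context model
begin

section \<open>The principles as statements about a model\<close>

definition trans :: bool where
  "trans \<longleftrightarrow> (\<forall>f \<in> st ty1. (\<forall>n \<in> st N. f \<bullet> n = z) \<longrightarrow> (\<forall>n \<in> D N. f \<bullet> n = z))"

definition decides :: "'a \<Rightarrow> bool" where
  "decides \<phi> \<longleftrightarrow> \<phi> \<in> D ty2 \<and> (\<forall>g \<in> D ty1. (\<exists>n \<in> D N. g \<bullet> n = z) \<longleftrightarrow> \<phi> \<bullet> g = z)"

definition listed :: "'a \<Rightarrow> 'a \<Rightarrow> bool" where
  "listed f n \<longleftrightarrow> (\<exists>m \<in> D N. f \<bullet> pr m n = z)"

definition separates :: "'a \<Rightarrow> bool" where
  "separates F \<longleftrightarrow> F \<in> D (ty1 \<rightarrow> ty1 \<rightarrow> N \<rightarrow> N) \<and> (\<forall>f \<in> D ty1. \<forall>g \<in> D ty1.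
    (\<forall>n \<in> D N. \<not> (listed f n \<and> listed g n)) \<longrightarrow>
    (\<forall>n \<in> D N. listed f n \<longrightarrow> F \<bullet> f \<bullet> g \<bullet> n = sc z) \<and>
    (\<forall>n \<in> D N. listed g n \<longrightarrow> F \<bullet> f \<bullet> g \<bullet> n = z))"

definition sep_star :: bool where
  "sep_star \<longleftrightarrow> (\<forall>f \<in> st ty1. \<forall>g \<in> st ty1.
    (\<forall>n \<in> st N. \<not> ((\<exists>m \<in> st N. f \<bullet> pr m n = z) \<and> (\<exists>m \<in> st N. g \<bullet> pr m n = z))) \<longrightarrow>
    (\<exists>Z \<in> st ty1. (\<forall>n \<in> D N. Z \<bullet> n = z \<or> Z \<bullet> n = sc z) \<and>
      (\<forall>n \<in> D N. (listed f n \<longrightarrow> Z \<bullet> n \<noteq> sc z) \<and> (listed g n \<longrightarrow> Z \<bullet> n = sc z))))"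

lemma sat_Pi01_TRANS: "sat [] Pi01_TRANS \<longleftrightarrow> trans"
  using st_in by (auto simp: Pi01_TRANS_def trans_def)

lemma sat_exists2: "sat [] exists2 \<longleftrightarrow> (\<exists>\<phi>. decides \<phi>)"
  by (auto simp: exists2_def decides_def)

lemma sat_Sigma01: "sat xs (Sigma01 f n) \<longleftrightarrow> listed (ev xs f) (ev xs n)"
  by (simp add: Sigma01_def listed_def)

lemma sat_USigma01_SEP: "sat [] USigma01_SEP \<longleftrightarrow> (\<exists>F. separates F)"
  by (simp add: USigma01_SEP_def separates_def sat_Sigma01 Bex_def)
    (rule arg_cong[where f = Ex], rule ext, blast)

text \<open>Stated for a variable \<open>V i\<close> because \<open>not_bounded_body\<close> asks
  for a variable at the head of the equation.\<close>

lemma sat_rel_Sigma01: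
  "sat xs (rel (Sigma01 (V i) n)) \<longleftrightarrow> (\<exists>m \<in> st N. xs ! i \<bullet> pr m (ev xs n) = z)"
  using st_in by (auto simp: Sigma01_def)

lemma sat_Sigma01_SEP_star: "sat [] Sigma01_SEP_star \<longleftrightarrow> sep_star"
proof -
  have [simp]: "(\<exists>x \<in> D \<sigma>. x \<in> st \<sigma> \<and> Q x) \<longleftrightarrow> (\<exists>x \<in> st \<sigma>. Q x)"
    "(\<forall>x \<in> D \<sigma>. x \<in> st \<sigma> \<longrightarrow> Q x) \<longleftrightarrow> (\<forall>x \<in> st \<sigma>. Q x)" for \<sigma> Q
    using st_in by blast+
  show ?thesis
    by (simp add: Sigma01_SEP_star_def sep_star_def sat_Sigma01 sat_rel_Sigma01 is_set_def elem_def disj_imp)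
qed

section \<open>Transfer, decision and separation\<close>

lemma flip:
  assumes f: "f \<in> D ty1"
  obtains g where "g \<in> D ty1" "\<forall>n \<in> D N. g \<bullet> n = (if f \<bullet> n = z then sc z else z)"
    "f \<in> st ty1 \<Longrightarrow> g \<in> st ty1"
  using abstract1[of N "[ty1]" "ifz_tm (V 1 \<cdot> V 0) One Zero" N "[f]"] f ap_in[OF f]
  by (auto simp: ifz_if)

text \<open>Transfer concerns functions that vanish everywhere, while search and decision concern a
  single zero; exchanging zero and nonzero values by \<open>flip\<close> translates between the
  two.\<close>

lemma trans_witness:
  assumes trans and g: "g \<in> st ty1" and n: "n \<in> D N" "g \<bullet> n = z"
  shows "\<exists>m \<in> st N. g \<bullet> m = z"
proof (rule ccontr)
  assume none: "\<not> ?thesis"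
  obtain f where f: "\<forall>n \<in> D N. f \<bullet> n = (if g \<bullet> n = z then sc z else z)" "f \<in> st ty1"
    using flip[OF st_in[OF g]] g by metis
  then have "\<forall>n \<in> D N. f \<bullet> n = z" using assms(1) none st_in unfolding trans_def by auto
  then show False using f n by auto
qed

lemma decides_imp_trans:
  assumes \<phi>: "decides \<phi>" shows trans
proof -
  \<comment> \<open>With \<open>\<phi>\<close> as a parameter, having a zero becomes an equation, so
    the matrix is quantifier-free; where there is no zero, the value \<open>z\<close>
    serves.\<close>
  obtain \<mu> where \<mu>: "\<mu> \<in> D ty2" "\<And>g. g \<in> D ty1 \<Longrightarrow> \<phi> \<bullet> g = z \<longrightarrow> g \<bullet> (\<mu> \<bullet> g) = z"
  proof (rule qf_choice[of "Imp (Eq (V 2 \<cdot> V 1) Zero) (Eq (V 1 \<cdot> V 0) Zero)" "[ty2]" "[\<phi>]"])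
    show "\<exists>n \<in> D N. sat [n, g, \<phi>] (Imp (Eq (V 2 \<cdot> V 1) Zero) (Eq (V 1 \<cdot> V 0) Zero))" if "g \<in> D ty1" for g
    proof (cases "\<phi> \<bullet> g = z")
      case True
      then show ?thesis using \<phi> that unfolding decides_def by auto
    next
      case False
      then show ?thesis by (intro bexI[of _ z]) auto
    qed
  qed (use \<phi> in \<open>auto simp: decides_def\<close>)
  \<comment> \<open>Here \<open>\<phi>\<close> is eliminated: the premise that its value at the
    function is zero is replaced by an actual zero of the function.\<close>
  let ?A = "Forall ty1 (Forall N (Imp (Eq (V 1 \<cdot> V 0) Zero) (Eq (V 1 \<cdot> (V 2 \<cdot> V 1)) Zero)))"
  have "sat [\<mu>] ?A" using \<mu> \<phi> unfolding decides_def by auto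
  then obtain \<nu> where "\<nu> \<in> st ty2" "sat [\<nu>] ?A"
    by (rule transfer_ex[OF _ _ \<mu>(1), rotated 2]) auto
  then have \<nu>: "\<nu> \<in> st ty2" "\<And>g n. g \<in> D ty1 \<Longrightarrow> n \<in> D N \<Longrightarrow> g \<bullet> n = z \<Longrightarrow> g \<bullet> (\<nu> \<bullet> g) = z"
    by auto
  show ?thesis unfolding trans_def
  proof (intro ballI impI, rule ccontr)
    fix f n assume f: "f \<in> st ty1" and all: "\<forall>n \<in> st N. f \<bullet> n = z" and n: "n \<in> D N" "f \<bullet> n \<noteq> z"
    obtain g where g: "g \<in> D ty1" "\<forall>n \<in> D N. g \<bullet> n = (if f \<bullet> n = z then sc z else z)" "g \<in> st ty1"
      using flip[OF st_in[OF f]] f by metis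
    have "\<nu> \<bullet> g \<in> st N" using ap_st \<nu>(1) g(3) by blast
    then show False using \<nu>(2)[OF g(1) n(1)] g(2) n all st_in by auto
  qed
qed

text \<open>\<open>HAC_int\<close> yields a functional that decides standard inputs only. It meets the relativised
  specification of the constant, which is not a parameter and hence can be transferred.\<close>
lemma trans_imp_decides:
  assumes T: trans and k: "\<Sigma> k = Some (ty2, exists2_spec)"
  shows "\<exists>\<phi> \<in> st ty2. decides \<phi>"
proof -
  \<comment> \<open>\<open>HAC_int\<close> accepts any internal formula, so the matrix may start
    from an unrestricted zero; transfer then supplies a standard one.\<close>
  let ?A = "Imp (Exists N (Eq (V 2 \<cdot> V 0) Zero)) (Eq (V 1 \<cdot> V 0) Zero)"
  obtain F where F: "F \<in> st (ty1 \<rightarrow> Star N)"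
    "\<And>g. g \<in> st ty1 \<Longrightarrow> \<exists>y \<in> D N. sat [y, g, F] (mem N (V 0) (V 2 \<cdot> V 1)) \<and> sat [y, g] ?A"
  proof (rule hac[of ?A N ty1])
    show "\<exists>y \<in> st N. sat [y, g] ?A" if "g \<in> st ty1" for g
      using trans_witness[OF T that] arith_st(1) by (cases "\<exists>n \<in> D N. g \<bullet> n = z") auto
  qed auto
  obtain W where W: "searches W" using search_exists ..
  then have Ws: "W \<in> st (ty1 \<rightarrow> N \<rightarrow> N)" by (simp add: searches_def)
  \<comment> \<open>\<open>Q g\<close> reads \<open>g\<close> along the finite sequence
    \<open>F g\<close>, so that searching \<open>Q g\<close> up to the length of the sequence tests
    all entries.\<close>
  obtain Q where Q: "Q \<in> st (ty1 \<rightarrow> ty1)"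
    "\<forall>g \<in> D ty1. \<forall>i \<in> D N. Q \<bullet> g \<bullet> i = g \<bullet> (cst (Nth N) \<bullet> (F \<bullet> g) \<bullet> i)"
    using abstract2[of N ty1 "[ty1 \<rightarrow> Star N]" "V 1 \<cdot> (Nth N \<cdot> (V 2 \<cdot> V 1) \<cdot> V 0)" N "[F]"] F(1) st_in by auto
  \<comment> \<open>The search includes the index just past the end; a zero found there is still a
    zero of \<open>g\<close>.\<close>
  obtain \<phi> where \<phi>: "\<phi> \<in> st ty2"
    "\<forall>g \<in> D ty1. \<phi> \<bullet> g = ifz (Q \<bullet> g \<bullet> (W \<bullet> (Q \<bullet> g) \<bullet> (cst (Len N) \<bullet> (F \<bullet> g)))) z (sc z)"
    using abstract1[of ty1 "[ty1 \<rightarrow> N \<rightarrow> N, ty1 \<rightarrow> ty1, ty1 \<rightarrow> Star N]"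
        "ifz_tm (V 2 \<cdot> V 0 \<cdot> (V 1 \<cdot> (V 2 \<cdot> V 0) \<cdot> (Len N \<cdot> (V 3 \<cdot> V 0)))) Zero One" N "[W, Q, F]"]
      F(1) Q(1) Ws st_in by auto
  \<comment> \<open>This is \<open>rel exists2_spec\<close> at \<open>\<phi>\<close>, unfolded:
    functions and zeros are standard, and the values are restricted to \<open>z\<close> and
    \<open>sc z\<close>, as the uniqueness of the specified functional requires.\<close>
  have \<phi>_st: "((\<exists>n \<in> st N. g \<bullet> n = z) \<longleftrightarrow> \<phi> \<bullet> g = z) \<and> (\<phi> \<bullet> g = z \<or> \<phi> \<bullet> g = sc z)"
    if g: "g \<in> st ty1" for g
  proof -
    let ?q = "Q \<bullet> g" and ?l = "cst (Len N) \<bullet> (F \<bullet> g)"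
    let ?w = "W \<bullet> ?q \<bullet> ?l"
    have q: "?q \<in> D ty1" using ap_st[OF Q(1) g] st_in by blast
    have Fg: "F \<bullet> g \<in> D (Star N)" using ap_st[OF F(1) g] st_in by blast
    have l: "?l \<in> D N" using ev_in[of "[Star N]" "Len N \<cdot> V 0" N "[F \<bullet> g]"] Fg by simp
    have w: "?w \<in> D N" using ap_in[OF ap_in[OF st_in[OF Ws] q] l] .
    have val: "\<phi> \<bullet> g = (if ?q \<bullet> ?w = z then z else sc z)"
      using \<phi>(2) st_in[OF g] ap_in[OF q w] by (simp add: ifz_if)
    have "?q \<bullet> ?w = z" if n: "n \<in> st N" "g \<bullet> n = z" for n
    proof -
      obtain y i where "g \<bullet> y = z" "i \<in> D N" "y = cst (Nth N) \<bullet> (F \<bullet> g) \<bullet> i" "mon (sc i) ?l = z"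
        using F(2)[OF g] n st_in[OF n(1)]
        by (auto simp: mem_def ForallLess_def lt_fm_def le_fm_def)
      moreover from this have "mon i ?l = z" using prd_mon_sc[of i ?l] l by simp
      ultimately show ?thesis using W q l Q(2) st_in[OF g] by (auto simp: searches_def)
    qed
    moreover have "\<exists>n \<in> st N. g \<bullet> n = z" if "?q \<bullet> ?w = z"
    proof (rule trans_witness[OF T g])
      show "cst (Nth N) \<bullet> (F \<bullet> g) \<bullet> ?w \<in> D N"
        using ev_in[of "[Star N, N]" "Nth N \<cdot> V 0 \<cdot> V 1" N "[F \<bullet> g, ?w]"] Fg w by simp
      show "g \<bullet> (cst (Nth N) \<bullet> (F \<bullet> g) \<bullet> ?w) = z" using that Q(2) st_in[OF g] w by simp
    qed
    ultimately show ?thesis using val by auto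
  qed
  have "sat [] (And (St ty2 (Xi k)) (ForallSt ty2 (Imp (rel exists2_spec) (rel (eq ty2 (Xi k) (V 0))))))"
    by (rule sat_axiom[OF Xi_spec[of \<Sigma> k, OF k]]) (simp_all add: k exists2_spec_def One_def)
  then have "cst (Xi k) \<in> st ty2" and
    "sat [\<phi>] (rel exists2_spec) \<Longrightarrow> sat [\<phi>] (rel (eq ty2 (Xi k) (V 0)))"
    using \<phi>(1) st_in by auto
  moreover have "sat [\<phi>] (rel exists2_spec)"
    using \<phi>_st st_in by (auto simp: exists2_spec_def) blast
  ultimately have Xi: "cst (Xi k) \<in> st ty2" "\<forall>g \<in> st ty1. cst (Xi k) \<bullet> g = \<phi> \<bullet> g"
    using st_in by auto
  let ?B = "Iff (Exists N (Eq (V 1 \<cdot> V 0) Zero)) (Eq (Xi k \<cdot> V 0) Zero)"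
  have "sat [g] ?B" if "g \<in> D ty1" for g
  proof (rule transfer_all[OF _ _ _ that])
    \<comment> \<open>On standard \<open>g\<close> transfer identifies having a zero with having a
      standard zero, and there the constant agrees with \<open>\<phi>\<close>.\<close>
    show "sat [g] ?B" if "g \<in> st ty1" for g
      using \<phi>_st[OF that] trans_witness[OF T that] Xi(2) that st_in by auto
  qed (simp_all add: k)
  then have "decides (cst (Xi k))" using Xi(1) st_in by (auto simp: decides_def)
  then show ?thesis using Xi(1) by blast
qed

text \<open>\<open>F\<close> tests membership in the set listed by its first argument; disjointness
  makes the answer right for the second.\<close>

lemma decides_imp_separates:
  assumes \<phi>: "decides \<phi>" shows "\<exists>F. separates F"
proof -
  have \<phi>D: "\<phi> \<in> D ty2" using \<phi> by (simp add: decides_def)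
  \<comment> \<open>\<open>P f n\<close> is the section of \<open>f\<close> at \<open>n\<close>, the
    function of one argument that \<open>\<phi>\<close> can decide.\<close>
  obtain P where P: "P \<in> D (ty1 \<rightarrow> N \<rightarrow> N \<rightarrow> N)"
    "\<forall>f \<in> D ty1. \<forall>n \<in> D N. \<forall>m \<in> D N. P \<bullet> f \<bullet> n \<bullet> m = f \<bullet> pr m n"
    using abstract3[of N N ty1 "[]" "V 2 \<cdot> pair_tm (V 0) (V 1)" N "[]"] by auto
  obtain F where F: "F \<in> D (ty1 \<rightarrow> ty1 \<rightarrow> N \<rightarrow> N)"
    "\<forall>f \<in> D ty1. \<forall>g \<in> D ty1. \<forall>n \<in> D N. F \<bullet> f \<bullet> g \<bullet> n = ifz (\<phi> \<bullet> (P \<bullet> f \<bullet> n)) (sc z) z"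
    using abstract3[of N ty1 ty1 "[ty1 \<rightarrow> N \<rightarrow> N \<rightarrow> N, ty2]" "ifz_tm (V 4 \<cdot> (V 3 \<cdot> V 2 \<cdot> V 0)) One Zero" N "[P, \<phi>]"]
      P(1) \<phi>D by auto
  have "F \<bullet> f \<bullet> g \<bullet> n = (if \<exists>m \<in> D N. f \<bullet> pr m n = z then sc z else z)"
    if f: "f \<in> D ty1" and g: "g \<in> D ty1" and n: "n \<in> D N" for f g n
  proof -
    have Pf: "P \<bullet> f \<bullet> n \<in> D ty1" using ap_in[OF ap_in[OF P(1) f] n] .
    have "(\<phi> \<bullet> (P \<bullet> f \<bullet> n) = z) \<longleftrightarrow> (\<exists>m \<in> D N. f \<bullet> pr m n = z)"
    proof -
      have "(\<exists>m \<in> D N. P \<bullet> f \<bullet> n \<bullet> m = z) \<longleftrightarrow> \<phi> \<bullet> (P \<bullet> f \<bullet> n) = z"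
        using \<phi> Pf unfolding decides_def by blast
      then show ?thesis using P(2) f n by simp
    qed
    then show ?thesis using F(2) f g n ap_in[OF \<phi>D Pf] by (auto simp: ifz_if)
  qed
  then have "separates F" using F(1) unfolding separates_def listed_def by auto
  then show ?thesis ..
qed

text \<open>With \<open>1\<close> the constant function, a zero of \<open>h(\<cdot>, 0)\<close> forces \<open>F(h, 1, 0) = 1\<close> and
  \<open>F(1, h, 0) = 0\<close>, so by extensionality every \<open>h\<close> has an argument at which either \<open>h\<close> differs
  from \<open>1\<close> or that certifies that \<open>h(\<cdot>, 0)\<close> has no zero. Choosing such arguments gives an unbounded
  search operator.\<close>
lemma separates_imp_decides:
  assumes F: "separates F" shows "\<exists>\<phi>. decides \<phi>"
proof -
  have FD: "F \<in> D (ty1 \<rightarrow> ty1 \<rightarrow> N \<rightarrow> N)" using F by (simp add: separates_def)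
  obtain u where u: "u \<in> D ty1" "\<forall>n \<in> D N. u \<bullet> n = sc z"
    using abstract1[of N "[]" One N "[]"] by auto
  have sep: "F \<bullet> h \<bullet> u \<bullet> z \<noteq> F \<bullet> u \<bullet> h \<bullet> z" if h: "h \<in> D ty1" and m: "m \<in> D N" "h \<bullet> pr m z = z" for h m
  proof -
    have nu: "u \<bullet> pr j n \<noteq> z" if "j \<in> D N" "n \<in> D N" for j n using u that by simp
    have "F \<bullet> h \<bullet> u \<bullet> z = sc z" using F h u(1) nu m unfolding separates_def listed_def by (metis arith_in(1))
    moreover have "F \<bullet> u \<bullet> h \<bullet> z = z" using F h u(1) nu m unfolding separates_def listed_def by (metis arith_in(1))
    ultimately show ?thesis by simp
  qed
  let ?A = "Imp (Eq (V 1 \<cdot> V 0) One) (Eq (V 2 \<cdot> V 1 \<cdot> V 3 \<cdot> Zero) (V 2 \<cdot> V 3 \<cdot> V 1 \<cdot> Zero))"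
  obtain \<Psi> where \<Psi>: "\<Psi> \<in> D ty2"
    "\<And>h. h \<in> D ty1 \<Longrightarrow> h \<bullet> (\<Psi> \<bullet> h) = sc z \<longrightarrow> F \<bullet> h \<bullet> u \<bullet> z = F \<bullet> u \<bullet> h \<bullet> z"
  proof (rule qf_choice[of ?A "[ty1 \<rightarrow> ty1 \<rightarrow> N \<rightarrow> N, ty1]" "[F, u]"])
    show "\<exists>n \<in> D N. sat [n, h, F, u] ?A" if h: "h \<in> D ty1" for h
    \<comment> \<open>For \<open>h = u\<close> the two sides of the equation coincide, so any number
      serves; \<open>z\<close> is taken.\<close>
    proof (cases "h = u")
      case True
      then show ?thesis by (intro bexI[of _ z]) auto
    next
      case False
      then obtain n where "n \<in> D N" "h \<bullet> n \<noteq> sc z" using fun_ext[OF h u(1)] u(2) by auto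
      then show ?thesis by auto
    qed
  qed (use FD u in auto)
  obtain W where W: "searches W" using search_exists ..
  then have WD: "W \<in> D (ty1 \<rightarrow> N \<rightarrow> N)" using st_in by (simp add: searches_def)
  \<comment> \<open>\<open>G f k\<close> is \<open>z\<close> if the search for a zero of
    \<open>f\<close> up to \<open>k\<close> succeeds, and \<open>sc z\<close> otherwise. An argument
    at which \<open>G f\<close> is not \<open>sc z\<close> is thus a sufficient search bound, and
    \<open>\<Psi>\<close> is to supply one.\<close>
  obtain G where G: "G \<in> D (ty1 \<rightarrow> N \<rightarrow> N)"
    "\<forall>f \<in> D ty1. \<forall>k \<in> D N. G \<bullet> f \<bullet> k = ifz (f \<bullet> (W \<bullet> f \<bullet> k)) z (sc z)"
    using abstract2[of N ty1 "[ty1 \<rightarrow> N \<rightarrow> N]" "ifz_tm (V 1 \<cdot> (V 2 \<cdot> V 1 \<cdot> V 0)) Zero One" N "[W]"] WD by auto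
  obtain \<phi> where \<phi>: "\<phi> \<in> D ty2" "\<forall>f \<in> D ty1. \<phi> \<bullet> f = f \<bullet> (W \<bullet> f \<bullet> (\<Psi> \<bullet> (G \<bullet> f)))"
    using abstract1[of ty1 "[ty1 \<rightarrow> N \<rightarrow> N, ty2, ty1 \<rightarrow> N \<rightarrow> N]" "V 0 \<cdot> (V 1 \<cdot> V 0 \<cdot> (V 2 \<cdot> (V 3 \<cdot> V 0)))" N "[W, \<Psi>, G]"]
      WD \<Psi>(1) G(1) by auto
  have "(\<exists>n \<in> D N. f \<bullet> n = z) \<longleftrightarrow> \<phi> \<bullet> f = z" if f: "f \<in> D ty1" for f
  proof
    have h: "G \<bullet> f \<in> D ty1" using ap_in[OF G(1) f] .
    have Wk: "W \<bullet> f \<bullet> k \<in> D N" if "k \<in> D N" for k using ap_in[OF ap_in[OF WD f] that] .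
    have \<Psi>h: "\<Psi> \<bullet> (G \<bullet> f) \<in> D N" using ap_in[OF \<Psi>(1) h] .
    have val: "G \<bullet> f \<bullet> k = (if f \<bullet> (W \<bullet> f \<bullet> k) = z then z else sc z)" if "k \<in> D N" for k
      using G(2) f that ap_in[OF f Wk[OF that]] by (simp add: ifz_if)
    show "\<exists>n \<in> D N. f \<bullet> n = z" if "\<phi> \<bullet> f = z"
      using that \<phi>(2) f Wk[OF \<Psi>h] by auto
    assume "\<exists>n \<in> D N. f \<bullet> n = z"
    then obtain n where n: "n \<in> D N" "f \<bullet> n = z" by blast
    \<comment> \<open>\<open>sep\<close> wants a zero of \<open>G f\<close> at a code with second
      component \<open>z\<close>; since \<open>pr n z\<close> bounds \<open>n\<close>, the search up
      to this code succeeds.\<close>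
    have "f \<bullet> (W \<bullet> f \<bullet> pr n z) = z" using W f n mon_pr[of n z] by (simp add: searches_def)
    then have "G \<bullet> f \<bullet> pr n z = z" using val n by simp
    then have "G \<bullet> f \<bullet> (\<Psi> \<bullet> (G \<bullet> f)) \<noteq> sc z" using sep[OF h n(1)] \<Psi>(2)[OF h] by blast
    then show "\<phi> \<bullet> f = z" using val[OF \<Psi>h] \<phi>(2) f by (auto split: if_splits)
  qed
  then have "decides \<phi>" using \<phi>(1) unfolding decides_def by blast
  then show ?thesis ..
qed

text \<open>The set listed by \<open>g\<close> is itself a separating set, standard because
  \<open>\<phi>\<close> is. What has to be shown is that disjointness, assumed only for standard
  numbers with standard witnesses, holds throughout.\<close>

lemma trans_imp_sep_star:
  assumes T: trans and \<phi>: "\<phi> \<in> st ty2" "decides \<phi>" shows sep_star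
  unfolding sep_star_def
proof (intro ballI impI)
  fix f g assume f: "f \<in> st ty1" and g: "g \<in> st ty1"
    and disj: "\<forall>n \<in> st N. \<not> ((\<exists>m \<in> st N. f \<bullet> pr m n = z) \<and> (\<exists>m \<in> st N. g \<bullet> pr m n = z))"
  obtain P where P: "P \<in> st (ty1 \<rightarrow> N \<rightarrow> N \<rightarrow> N)"
    "\<forall>f \<in> D ty1. \<forall>n \<in> D N. \<forall>m \<in> D N. P \<bullet> f \<bullet> n \<bullet> m = f \<bullet> pr m n"
    using abstract3[of N N ty1 "[]" "V 2 \<cdot> pair_tm (V 0) (V 1)" N "[]"] by auto
  have PD: "P \<bullet> h \<bullet> n \<in> D ty1" if "h \<in> D ty1" "n \<in> D N" for h n
    using ap_in[OF ap_in[OF st_in[OF P(1)] that(1)] that(2)] .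
  have dec: "\<phi> \<bullet> (P \<bullet> h \<bullet> n) = z \<longleftrightarrow> (\<exists>m \<in> D N. h \<bullet> pr m n = z)" if "h \<in> D ty1" "n \<in> D N" for h n
  proof -
    have "(\<exists>m \<in> D N. P \<bullet> h \<bullet> n \<bullet> m = z) \<longleftrightarrow> \<phi> \<bullet> (P \<bullet> h \<bullet> n) = z"
      using \<phi>(2) PD[OF that] unfolding decides_def by blast
    then show ?thesis using P(2) that by simp
  qed
  have decD: "\<phi> \<bullet> (P \<bullet> h \<bullet> n) \<in> D N" if "h \<in> D ty1" "n \<in> D N" for h n
    using ap_in[OF st_in[OF \<phi>(1)] PD[OF that]] .
  let ?E = "[ty1, ty1, ty1 \<rightarrow> N \<rightarrow> N \<rightarrow> N, ty2]" and ?xs = "[f, g, P, \<phi>]"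
  have st: "st_env ?xs ?E" "env ?xs ?E" using f g P(1) \<phi>(1) st_in by auto
  obtain Z where Z: "Z \<in> st ty1" "\<forall>n \<in> D N. Z \<bullet> n = ifz (\<phi> \<bullet> (P \<bullet> g \<bullet> n)) (sc z) z"
    using abstract1[of N ?E "ifz_tm (V 4 \<cdot> (V 3 \<cdot> V 2 \<cdot> V 0)) One Zero" N ?xs] st by auto
  have val: "Z \<bullet> n = (if \<exists>m \<in> D N. g \<bullet> pr m n = z then sc z else z)" if "n \<in> D N" for n
    using Z(2) that dec[OF st_in[OF g] that] decD[OF st_in[OF g] that] by (simp add: ifz_if)
  \<comment> \<open>The zeros of \<open>C\<close> are the common members of the two sets. If there
    were one, transfer would give a standard common member, and then standard witnesses for both
    memberships.\<close>
  obtain C where C: "C \<in> st ty1" "\<forall>n \<in> D N. C \<bullet> n = ifz (\<phi> \<bullet> (P \<bullet> f \<bullet> n)) (\<phi> \<bullet> (P \<bullet> g \<bullet> n)) (sc z)"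
    using abstract1[of N ?E "ifz_tm (V 4 \<cdot> (V 3 \<cdot> V 1 \<cdot> V 0)) (V 4 \<cdot> (V 3 \<cdot> V 2 \<cdot> V 0)) One" N ?xs] st by auto
  have Cval: "C \<bullet> n = z \<longleftrightarrow> (\<exists>m \<in> D N. f \<bullet> pr m n = z) \<and> (\<exists>m \<in> D N. g \<bullet> pr m n = z)" if "n \<in> D N" for n
    using C(2) that dec[OF st_in[OF g] that] decD[OF st_in[OF g] that]
      dec[OF st_in[OF f] that] decD[OF st_in[OF f] that] by (simp add: ifz_if)
  have stw: "\<exists>m \<in> st N. h \<bullet> pr m n = z" if h: "h \<in> st ty1" and n: "n \<in> st N" and m: "m \<in> D N" "h \<bullet> pr m n = z" for h n m
    using trans_witness[OF T ap_st[OF ap_st[OF P(1) h] n], of m] P(2) m st_in[OF h] st_in[OF n] st_in by auto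
  have "C \<bullet> n \<noteq> z" if "n \<in> D N" for n
  proof
    assume "C \<bullet> n = z"
    from trans_witness[OF T C(1) that this] obtain m where m: "m \<in> st N" "C \<bullet> m = z" by blast
    then show False using Cval[OF st_in[OF m(1)]] disj stw[OF f m(1)] stw[OF g m(1)] by blast
  qed
  then show "\<exists>Z \<in> st ty1. (\<forall>n \<in> D N. Z \<bullet> n = z \<or> Z \<bullet> n = sc z) \<and>
      (\<forall>n \<in> D N. (listed f n \<longrightarrow> Z \<bullet> n \<noteq> sc z) \<and> (listed g n \<longrightarrow> Z \<bullet> n = sc z))"
    using Z(1) val Cval unfolding listed_def by (intro bexI[of _ Z]) auto
qed

text \<open>If transfer fails for \<open>f\<close>, the set on which the bounded search for a nonzero value of \<open>f\<close>
  succeeds is empty from the standard point of view, so it is to be separated from itself.\<close>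
lemma sep_star_imp_trans:
  assumes sep_star shows trans
  unfolding trans_def
proof (intro ballI impI, rule ccontr)
  fix f n assume f: "f \<in> st ty1" and all: "\<forall>n \<in> st N. f \<bullet> n = z" and n: "n \<in> D N" "f \<bullet> n \<noteq> z"
  obtain q where q: "q \<in> D ty1" "\<forall>n \<in> D N. q \<bullet> n = (if f \<bullet> n = z then sc z else z)" "q \<in> st ty1"
    using flip[OF st_in[OF f]] f by metis
  obtain W where W: "searches W" using search_exists ..
  then have Ws: "W \<in> st (ty1 \<rightarrow> N \<rightarrow> N)" by (simp add: searches_def)
  \<comment> \<open>A zero of \<open>h\<close> at \<open>k\<close> records that the search up to
    \<open>k\<close> succeeded. For standard \<open>k\<close> this is impossible:
    \<open>W \<bullet> q \<bullet> k\<close> is then standard, and \<open>q\<close> has no standard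
    zero.\<close>
  obtain h where h: "h \<in> st ty1" "\<forall>k \<in> D N. h \<bullet> k = q \<bullet> (W \<bullet> q \<bullet> k)"
    using abstract1[of N "[ty1, ty1 \<rightarrow> N \<rightarrow> N]" "V 1 \<cdot> (V 2 \<cdot> V 1 \<cdot> V 0)" N "[q, W]"] q Ws st_in by auto
  have "h \<bullet> k \<noteq> z" if "k \<in> st N" for k
  proof -
    have w: "W \<bullet> q \<bullet> k \<in> st N" using ap_st[OF ap_st[OF Ws q(3)] that] .
    show ?thesis using h(2) st_in[OF that] q(2) st_in[OF w] all w by simp
  qed
  then have "\<forall>n \<in> st N. \<not> ((\<exists>m \<in> st N. h \<bullet> pr m n = z) \<and> (\<exists>m \<in> st N. h \<bullet> pr m n = z))"
    using arith_st(2) by blast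
  then obtain Z where Z: "\<forall>n \<in> D N. (listed h n \<longrightarrow> Z \<bullet> n \<noteq> sc z) \<and> (listed h n \<longrightarrow> Z \<bullet> n = sc z)"
    using assms h(1) unfolding sep_star_def by blast
  \<comment> \<open>The code \<open>pr n z\<close> bounds the zero \<open>n\<close> of
    \<open>q\<close>, so \<open>h\<close> vanishes there and \<open>n\<close> witnesses that
    \<open>z\<close> is listed.\<close>
  have "q \<bullet> (W \<bullet> q \<bullet> pr n z) = z" using W q n mon_pr[of n z] by (simp add: searches_def)
  then have "h \<bullet> pr n z = z" using h(2) n by simp
  then have "listed h z" using n by (auto simp: listed_def)
  then show False using Z arith_in(1) by blast
qed

end

lemma wf_principles:
  "wf_fm \<Sigma> [] Pi01_TRANS" "wf_fm \<Sigma> [] exists2" "wf_fm \<Sigma> [] USigma01_SEP" "wf_fm \<Sigma> [] Sigma01_SEP_star"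
  by (simp_all add: Pi01_TRANS_def exists2_def USigma01_SEP_def Sigma01_SEP_star_def Sigma01_def
      is_set_def elem_def numeral_eq_Suc)

theorem corollary3p9:
  fixes \<Sigma> :: sig
  assumes "admissible \<Sigma>"
  shows "proves \<Sigma> (RCA0_Omega \<Sigma>) [] [] (Iff Pi01_TRANS Sigma01_SEP_star)
       \<and> proves \<Sigma> (RCA0_Omega \<Sigma>) [] [] (Iff Sigma01_SEP_star USigma01_SEP)
       \<and> proves \<Sigma> (RCA0_Omega \<Sigma>) [] [] (Iff USigma01_SEP exists2)"
proof -
  obtain k where k: "\<Sigma> k = Some (ty2, exists2_spec)"
    using assms by (auto simp: admissible_def)
  have equiv: "interp.sat D ap cst st [] Pi01_TRANS = interp.sat D ap cst st [] Sigma01_SEP_star \<and>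
      interp.sat D ap cst st [] Sigma01_SEP_star = interp.sat D ap cst st [] USigma01_SEP \<and>
      interp.sat D ap cst st [] USigma01_SEP = interp.sat D ap cst st [] exists2"
    if "model \<Sigma> D ap cst st" for D ap cst and st :: "ty \<Rightarrow> tm set"
  proof -
    interpret model \<Sigma> D ap cst st by fact
    show ?thesis
      unfolding sat_Pi01_TRANS sat_Sigma01_SEP_star sat_USigma01_SEP sat_exists2
      \<comment> \<open>Transfer and \<open>exists2\<close> are the hub:
        \<open>Sigma01_SEP_star\<close> is tied to the first and \<open>USigma01_SEP\<close> to the
        second. The standard functional obtained from transfer also feeds
        \<open>trans_imp_sep_star\<close>.\<close>
      using decides_imp_trans trans_imp_decides[OF _ k] decides_imp_separates separates_imp_decides
        trans_imp_sep_star sep_star_imp_trans by blast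
  qed
  have "derives \<Sigma> [] [] (Iff A B)"
    if "wf_fm \<Sigma> [] A" "wf_fm \<Sigma> [] B"
      and "\<And>D ap cst (st :: ty \<Rightarrow> tm set). model \<Sigma> D ap cst st \<Longrightarrow> interp.sat D ap cst st [] A = interp.sat D ap cst st [] B"
    for A B
    by (rule completeness) (use that in \<open>auto simp: interp.sat.simps\<close>)
  then show ?thesis using equiv wf_principles by blast
qed

end
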